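(* In the special case of the Heterogeneous Task Allocation Problem (HTAP) where there is exactly one agent of each type (i.e. $m_i=1$ for all $1\le i\le m$, so the heterogeneous agents are distinct), \textsc{CycleSplit} (using \textit{SPLITOUR} for task splitting) is a $\left(4-\frac{1}{k}\right)$-approximation algorithm, where $k$ is the number of agents. That is, for every such instance with $k$ agents, it efficiently returns a set of tours, one per agent, that forms a feasible solution and whose maximum cost is at most $\left(4-\frac{1}{k}\right)$ times the optimal value of the instance.
   Context: **The problem (HTAP).** There are $k$ agents $A_1,\dots,A_k$, partitioned into $m$ types by a function $f:\{1,\dots,k\}\to\{1,\dots,m\}$; $m_i\ge 1$ is the number of agents of type $i$, so $\sum_{i=1}^m m_i=k$. A finite task set $T$ is partitioned as $T=T_0\cup T_1\cup\dots\cup T_m$, where $T_0$ is the set of generic tasks (which any agent can perform) and, for $1\le i\le m$, $T_i$ is the set of type-specific tasks that only agents of type $i$ can perform. All agents start at a node $v_s$. On the vertex set $V=T\cup\{v_s\}$ consider the complete undirected graph $G$ with edge weights (distances) $d(u,v)\ge 0$ satisfying the triangle inequality. A tour on $V'\subseteq V$ is a closed path starting and ending at $v_s$ that visits all nodes of $V'$; its cost is the sum of its edge weights. $C^*(V')$ is the minimum cost of a tour on $V'$ (with $C^*(\emptyset)=0$). HTAP asks for $$\min_{S_1,\dots,S_k\subseteq T}\ \max_{1\le j\le k} C^*(S_j)\quad\text{subject to}\quad \bigcup_{j=1}^k S_j=T,\quad S_j=V_j\cup R_j,\ V_j\subseteq T_{f(j)},\ R_j\subseteq T_0\ \ (1\le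 j\le k).$$ A feasible solution consists of such an allocation together with a tour on $S_j$ for each agent $A_j$; its value is the maximum cost of these tours. An $\alpha$-approximation algorithm is an algorithm that efficiently (in polynomial time) finds, for every instance, a feasible solution whose value is at most $\alpha$ times the optimum. **Christofides' tour.** The tour through $v_s$ and a given set of tasks produced by Christofides' algorithm for the metric traveling salesperson problem ($\frac32$-approximation). **SPLITOUR** (Frederickson, Hecht, Kim). Input: a tour of cost $L$ on nodes $v_1,\dots,v_n$, listed in tour order with $v_1=v_s$, and an integer $q\ge 1$. Let $c_{\max}=\max_{1<i\le n} d(v_1,v_i)$. For $1\le j<q$, let $v_{p(j)}$ be the last vertex along the tour such that the cost of traversing the tour from $v_1$ to $v_{p(j)}$ is at most $\frac{j}{q}(L-2c_{\max})+c_{\max}$. Output: the $q$ subtours $(v_1,\dots,v_{p(1)},v_1)$, $(v_1,v_{p(1)+1},\dots,v_{p(2)},v_1)$, $\dots$, $(v_1,v_{p(q-1)+1},\dots,v_n,v_1)$. **Algorithm CycleSplit (with SPLITOUR).** (1) For each type $i$, $1\le i\le m$: find Christofides' tour (starting and ending at $v_s$) on $T_i$, split it with SPLITOUR into $m_i$ subtours starting and ending at $v_s$, and allocate one subtour to each agent of type $i$. (2) Find Christofides' tour (starting and ending at $v_s$) on $T_0$, split it with SPLITOUR into $k$ subtours $R_1,\dots,R_k$ starting and ending at $v_s$, and allocate $R_j$ to agent $A_j$, $1\le j\le k$. (3) For each agent, combine its type-specific subtour and its generic subtour into one tour (concatenating them at $v_s$), and return the resulting tour for each agent. *)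

theory Defs
  imports
    Complex_Main
    "HOL-Library.Multiset"
    "HOL-Library.FuncSet"
    "HOL-Library.Disjoint_Sets"
    "HOL-Library.Monad_Syntax"
    "HOL-Library.Time_Functions"
    "HOL-Computational_Algebra.Polynomial"
begin

section \<open>Weighted complete graphs and walks\<close>

text \<open>A trivial tour uses the non-existing edge from the depot to itself; hence the convention
  \<open>d u u = 0\<close>. Distinct nodes may have distance \<open>0\<close>.\<close>

definition metric_on :: "'a set \<Rightarrow> ('a \<Rightarrow> 'a \<Rightarrow> real) \<Rightarrow> bool" where
  "metric_on V d \<longleftrightarrow>
     (\<forall>u\<in>V. d u u = 0) \<and>
     (\<forall>u\<in>V. \<forall>v\<in>V. 0 \<le> d u v \<and> d u v = d v u) \<and>
     (\<forall>u\<in>V. \<forall>v\<in>V. \<forall>w\<in>V. d u w \<le> d u v + d v w)"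

fun walk_cost :: "('a \<Rightarrow> 'a \<Rightarrow> real) \<Rightarrow> 'a list \<Rightarrow> real" where
  "walk_cost d (u # v # w) = d u v + walk_cost d (v # w)"
| "walk_cost d _ = 0"

section \<open>The Heterogeneous Task Allocation Problem\<close>

text \<open>Agents are numbered \<open>0, \<dots>, k - 1\<close> and types \<open>1, \<dots>, m\<close>. \<open>tasks I 0\<close> are the generic
  tasks, \<open>tasks I i\<close> for \<open>1 \<le> i \<le> m\<close> those specific to type \<open>i\<close>.\<close>

record 'a htap =
  n_agents :: nat
  n_types :: nat
  agent_type :: "nat \<Rightarrow> nat"
  tasks :: "nat \<Rightarrow> 'a set"
  depot :: 'a
  distance :: "'a \<Rightarrow> 'a \<Rightarrow> real"

definition all_tasks :: "'a htap \<Rightarrow> 'a set" where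
  "all_tasks I = (\<Union>i\<le>n_types I. tasks I i)"

definition vertices :: "'a htap \<Rightarrow> 'a set" where
  "vertices I = insert (depot I) (all_tasks I)"

definition type_count :: "'a htap \<Rightarrow> nat \<Rightarrow> nat" where
  "type_count I i = card {j. j < n_agents I \<and> agent_type I j = i}"

definition htap_instance :: "'a htap \<Rightarrow> bool" where
  "htap_instance I \<longleftrightarrow>
     1 \<le> n_agents I \<and>
     agent_type I \<in> {..<n_agents I} \<rightarrow> {1..n_types I} \<and>
     (\<forall>i\<in>{1..n_types I}. 1 \<le> type_count I i) \<and>
     finite (all_tasks I) \<and>
     disjoint_family_on (tasks I) {..n_types I} \<and>
     depot I \<notin> all_tasks I \<and>
     metric_on (vertices I) (distance I)"

definition is_tour :: "'a htap \<Rightarrow> 'a set \<Rightarrow> 'a list \<Rightarrow> bool" where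
  "is_tour I S w \<longleftrightarrow>
     w \<noteq> [] \<and> hd w = depot I \<and> last w = depot I \<and> set w \<subseteq> vertices I \<and> S \<subseteq> set w"

abbreviation tour_cost :: "'a htap \<Rightarrow> 'a list \<Rightarrow> real" where
  "tour_cost I w \<equiv> walk_cost (distance I) w"

text \<open>The infimum is attained, see \<open>min_tour_cost_attained\<close>.\<close>

definition min_tour_cost :: "'a htap \<Rightarrow> 'a set \<Rightarrow> real" where
  "min_tour_cost I S = Inf {tour_cost I w | w. is_tour I S w}"

definition allocation :: "'a htap \<Rightarrow> (nat \<Rightarrow> 'a set) \<Rightarrow> bool" where
  "allocation I S \<longleftrightarrow>
     (\<Union>j<n_agents I. S j) = all_tasks I \<and>
     (\<exists>V R. \<forall>j<n_agents I.
        S j = V j \<union> R j \<and> V j \<subseteq> tasks I (agent_type I j) \<and> R j \<subseteq> tasks I 0)"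

text \<open>The set is finite and nonempty, see \<open>htap_opt_attained\<close>.\<close>

definition htap_opt :: "'a htap \<Rightarrow> real" where
  "htap_opt I = Min {Max ((\<lambda>j. min_tour_cost I (S j)) ` {..<n_agents I}) | S. allocation I S}"

definition feasible_solution :: "'a htap \<Rightarrow> 'a list list \<Rightarrow> bool" where
  "feasible_solution I ws \<longleftrightarrow>
     length ws = n_agents I \<and>
     (\<exists>S. allocation I S \<and> (\<forall>j<n_agents I. is_tour I (S j) (ws ! j)))"

definition solution_value :: "'a htap \<Rightarrow> 'a list list \<Rightarrow> real" where
  "solution_value I ws = Max (tour_cost I ` set ws)"

section \<open>Counting elementary steps\<close>

text \<open>A timed computation is its result paired with its number of steps. Arithmetic and comparisons
  on reals and naturals, evaluations of the distance function, and accesses to the components of an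
  instance have unit cost; they are accounted for by the tick of the surrounding recursive call.
  List operations are charged their library running time.\<close>

type_synonym 'a timed = "'a \<times> nat"

definition timed_return :: "'a \<Rightarrow> 'a timed" where
  "timed_return x = (x, 0)"

definition timed_bind :: "'a timed \<Rightarrow> ('a \<Rightarrow> 'b timed) \<Rightarrow> 'b timed" where
  "timed_bind c f = (fst (f (fst c)), snd c + snd (f (fst c)))"

adhoc_overloading bind \<rightleftharpoons> timed_bind

definition tick :: "unit timed" where
  "tick = ((), 1)"

lemma timed_bind_cong [fundef_cong]:
  "c = c' \<Longrightarrow> (\<And>x. x = fst c' \<Longrightarrow> f x = f' x) \<Longrightarrow> timed_bind c f = timed_bind c' f'"
  by (simp add: timed_bind_def)

definition append_t :: "'a list \<Rightarrow> 'a list \<Rightarrow> 'a list timed" where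
  "append_t xs ys = (xs @ ys, T_append xs ys)"

definition take_t :: "nat \<Rightarrow> 'a list \<Rightarrow> 'a list timed" where
  "take_t n xs = (take n xs, T_take n xs)"

definition drop_t :: "nat \<Rightarrow> 'a list \<Rightarrow> 'a list timed" where
  "drop_t n xs = (drop n xs, T_drop n xs)"

definition nth_t :: "'a list \<Rightarrow> nat \<Rightarrow> 'a timed" where
  "nth_t xs n = (xs ! n, T_nth xs n)"

definition length_t :: "'a list \<Rightarrow> nat timed" where
  "length_t xs = (length xs, T_length xs)"

fun enum_t :: "nat \<Rightarrow> nat \<Rightarrow> nat list timed" where
  "enum_t i 0 = do {tick; timed_return []}"
| "enum_t i (Suc n) = do {tick; js \<leftarrow> enum_t (Suc i) n; timed_return (i # js)}"

fun map_t :: "('a \<Rightarrow> 'b timed) \<Rightarrow> 'a list \<Rightarrow> 'b list timed" where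
  "map_t f [] = do {tick; timed_return []}"
| "map_t f (x # xs) = do {tick; y \<leftarrow> f x; ys \<leftarrow> map_t f xs; timed_return (y # ys)}"

section \<open>Christofides' algorithm\<close>

text \<open>Undirected edges are two-element sets of nodes; \<open>d\<close> is symmetric wherever
  \<open>edge_weight\<close> is used.\<close>

definition edge_weight :: "('a \<Rightarrow> 'a \<Rightarrow> real) \<Rightarrow> 'a set \<Rightarrow> real" where
  "edge_weight d e = (THE x. \<exists>u v. e = {u, v} \<and> x = d u v)"

definition edges_on :: "'a set \<Rightarrow> 'a set set" where
  "edges_on V = {{u, v} | u v. u \<in> V \<and> v \<in> V \<and> u \<noteq> v}"

definition walk_edges :: "'a list \<Rightarrow> 'a set list" where
  "walk_edges w = map (\<lambda>(u, v). {u, v}) (zip w (tl w))"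

definition connected_graph :: "'a set \<Rightarrow> 'a set set \<Rightarrow> bool" where
  "connected_graph V E \<longleftrightarrow> (\<forall>u\<in>V. \<forall>v\<in>V. (u, v) \<in> {(x, y). {x, y} \<in> E}\<^sup>*)"

definition acyclic_graph :: "'a set set \<Rightarrow> bool" where
  "acyclic_graph E \<longleftrightarrow>
     \<not> (\<exists>c. 3 \<le> length c \<and> distinct c \<and> set (walk_edges (c @ [hd c])) \<subseteq> E)"

definition spanning_tree :: "'a set \<Rightarrow> 'a set set \<Rightarrow> bool" where
  "spanning_tree V E \<longleftrightarrow> E \<subseteq> edges_on V \<and> connected_graph V E \<and> acyclic_graph E"

definition min_spanning_tree :: "('a \<Rightarrow> 'a \<Rightarrow> real) \<Rightarrow> 'a set \<Rightarrow> 'a set set \<Rightarrow> bool" where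
  "min_spanning_tree d V E \<longleftrightarrow>
     spanning_tree V E \<and>
     (\<forall>E'. spanning_tree V E' \<longrightarrow> sum (edge_weight d) E \<le> sum (edge_weight d) E')"

definition odd_nodes :: "'a set \<Rightarrow> 'a set set \<Rightarrow> 'a set" where
  "odd_nodes V E = {v \<in> V. odd (card {e \<in> E. v \<in> e})}"

definition perfect_matching :: "'a set \<Rightarrow> 'a set set \<Rightarrow> bool" where
  "perfect_matching U M \<longleftrightarrow> M \<subseteq> edges_on U \<and> (\<forall>v\<in>U. \<exists>!e. e \<in> M \<and> v \<in> e)"

definition min_perfect_matching :: "('a \<Rightarrow> 'a \<Rightarrow> real) \<Rightarrow> 'a set \<Rightarrow> 'a set set \<Rightarrow> bool" where
  "min_perfect_matching d U M \<longleftrightarrow>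
     perfect_matching U M \<and>
     (\<forall>M'. perfect_matching U M' \<longrightarrow> sum (edge_weight d) M \<le> sum (edge_weight d) M')"

definition eulerian_circuit :: "'a set \<Rightarrow> 'a set multiset \<Rightarrow> 'a \<Rightarrow> 'a list \<Rightarrow> bool" where
  "eulerian_circuit V E s w \<longleftrightarrow>
     w \<noteq> [] \<and> hd w = s \<and> last w = s \<and> set w = V \<and> mset (walk_edges w) = E"

text \<open>The node lists that Christofides' algorithm may return for the depot \<open>s\<close> and the tasks \<open>S\<close>,
  whichever minimum spanning tree, matching and Eulerian circuit it picks. An edge that lies in both
  the tree and the matching is used twice by the circuit. \<open>rev (remdups (rev w))\<close> keeps the first
  occurrence of every node. The return to \<open>s\<close> is left implicit in the result.\<close>

definition christofides_tour ::
  "('a \<Rightarrow> 'a \<Rightarrow> real) \<Rightarrow> 'a \<Rightarrow> 'a set \<Rightarrow> 'a list \<Rightarrow> bool" where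
  "christofides_tour d s S vs \<longleftrightarrow>
     (\<exists>E M w.
        min_spanning_tree d (insert s S) E \<and>
        min_perfect_matching d (odd_nodes (insert s S) E) M \<and>
        eulerian_circuit (insert s S) (mset_set E + mset_set M) s w \<and>
        vs = rev (remdups (rev w)))"

definition christofides_algorithm ::
  "(('a \<Rightarrow> 'a \<Rightarrow> real) \<Rightarrow> 'a \<Rightarrow> 'a set \<Rightarrow> 'a list timed) \<Rightarrow> bool" where
  "christofides_algorithm chr \<longleftrightarrow>
     (\<forall>d s S. finite S \<and> s \<notin> S \<and> metric_on (insert s S) d \<longrightarrow>
        christofides_tour d s S (fst (chr d s S))) \<and>
     (\<exists>p :: nat poly. \<forall>d s S. finite S \<and> s \<notin> S \<and> metric_on (insert s S) d \<longrightarrow>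
        snd (chr d s S) \<le> poly p (card S))"

section \<open>SPLITOUR\<close>

fun walk_cost_t :: "('a \<Rightarrow> 'a \<Rightarrow> real) \<Rightarrow> 'a list \<Rightarrow> real timed" where
  "walk_cost_t d (u # v # w) = do {tick; c \<leftarrow> walk_cost_t d (v # w); timed_return (d u v + c)}"
| "walk_cost_t d _ = do {tick; timed_return 0}"

fun max_dist_t :: "('a \<Rightarrow> 'a \<Rightarrow> real) \<Rightarrow> 'a \<Rightarrow> 'a list \<Rightarrow> real timed" where
  "max_dist_t d s [] = do {tick; timed_return 0}"
| "max_dist_t d s (v # vs) = do {tick; c \<leftarrow> max_dist_t d s vs; timed_return (max (d s v) c)}"

text \<open>Scans the tour from its \<open>i\<close>-th node \<open>u\<close> on, where \<open>c\<close> is the cost of reaching \<open>u\<close> and \<open>p\<close> is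
  the position of the last node so far that was reached at cost at most \<open>b\<close>.\<close>

fun last_within_t ::
  "('a \<Rightarrow> 'a \<Rightarrow> real) \<Rightarrow> real \<Rightarrow> nat \<Rightarrow> nat \<Rightarrow> real \<Rightarrow> 'a \<Rightarrow> 'a list \<Rightarrow> nat timed" where
  "last_within_t d b i p c u [] = do {tick; timed_return p}"
| "last_within_t d b i p c u (v # vs) = do {
     tick;
     last_within_t d b (Suc i) (if c + d u v \<le> b then Suc i else p) (c + d u v) v vs
   }"

definition split_point_t :: "('a \<Rightarrow> 'a \<Rightarrow> real) \<Rightarrow> real \<Rightarrow> 'a list \<Rightarrow> nat timed" where
  "split_point_t d b vs = last_within_t d b 1 1 0 (hd vs) (tl vs)"

text \<open>For consecutive positions \<open>p, p'\<close> in the list, the subtour \<open>(v\<^sub>1, v\<^sub>p\<^sub>+\<^sub>1, \<dots>, v\<^sub>p\<^sub>', v\<^sub>1)\<close>.\<close>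

fun subtours_t :: "'a list \<Rightarrow> nat list \<Rightarrow> 'a list list timed" where
  "subtours_t vs (p # p' # ps) = do {
     tick;
     xs \<leftarrow> take_t p' vs;
     ys \<leftarrow> drop_t p xs;
     w \<leftarrow> append_t ys [hd vs];
     ws \<leftarrow> subtours_t vs (p' # ps);
     timed_return ((hd vs # w) # ws)
   }"
| "subtours_t vs _ = do {tick; timed_return []}"

definition splitour :: "('a \<Rightarrow> 'a \<Rightarrow> real) \<Rightarrow> 'a list \<Rightarrow> nat \<Rightarrow> 'a list list timed" where
  "splitour d vs q = do {
     tick;
     tour \<leftarrow> append_t vs [hd vs];
     L \<leftarrow> walk_cost_t d tour;
     cmax \<leftarrow> max_dist_t d (hd vs) (tl vs);
     js \<leftarrow> enum_t 1 (q - 1);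
     ps \<leftarrow> map_t (\<lambda>j. split_point_t d (real j / real q * (L - 2 * cmax) + cmax) vs) js;
     n \<leftarrow> length_t vs;
     ps' \<leftarrow> append_t ps [n];
     subtours_t vs (1 # ps')
   }"

section \<open>CycleSplit\<close>

fun count_type_t :: "(nat \<Rightarrow> nat) \<Rightarrow> nat \<Rightarrow> nat \<Rightarrow> nat timed" where
  "count_type_t f i 0 = do {tick; timed_return 0}"
| "count_type_t f i (Suc j) = do {
     tick;
     n \<leftarrow> count_type_t f i j;
     timed_return (if f j = i then Suc n else n)
   }"

text \<open>The subtours of type \<open>i\<close> are handed out to the agents of type \<open>i\<close> in the order of their
  numbers.\<close>

definition cycle_split ::
  "(('a \<Rightarrow> 'a \<Rightarrow> real) \<Rightarrow> 'a \<Rightarrow> 'a set \<Rightarrow> 'a list timed) \<Rightarrow> 'a htap \<Rightarrow> 'a list list timed" where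
  "cycle_split chr I = do {
     tick;
     types \<leftarrow> enum_t 1 (n_types I);
     specific \<leftarrow> map_t (\<lambda>i. do {
         vs \<leftarrow> chr (distance I) (depot I) (tasks I i);
         q \<leftarrow> count_type_t (agent_type I) i (n_agents I);
         splitour (distance I) vs q
       }) types;
     vs \<leftarrow> chr (distance I) (depot I) (tasks I 0);
     generic \<leftarrow> splitour (distance I) vs (n_agents I);
     agents \<leftarrow> enum_t 0 (n_agents I);
     map_t (\<lambda>j. do {
         ts \<leftarrow> nth_t specific (agent_type I j - 1);
         r \<leftarrow> count_type_t (agent_type I) (agent_type I j) j;
         t \<leftarrow> nth_t ts r;
         g \<leftarrow> nth_t generic j;
         append_t t (tl g)
       }) agents
   }"

section \<open>Approximation algorithms\<close>

definition instance_size :: "'a htap \<Rightarrow> nat" where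
  "instance_size I = n_agents I + card (vertices I)"

definition approximation_algorithm ::
  "('a htap \<Rightarrow> 'a list list timed) \<Rightarrow> 'a htap set \<Rightarrow> ('a htap \<Rightarrow> real) \<Rightarrow> bool" where
  "approximation_algorithm A \<I> \<alpha> \<longleftrightarrow>
     (\<forall>I\<in>\<I>. feasible_solution I (fst (A I)) \<and>
              solution_value I (fst (A I)) \<le> \<alpha> I * htap_opt I) \<and>
     (\<exists>p :: nat poly. \<forall>I\<in>\<I>. snd (A I) \<le> poly p (instance_size I))"

section \<open>The minima are attained\<close>

lemma walk_cost_append:
  "p \<noteq> [] \<Longrightarrow> r \<noteq> [] \<Longrightarrow> walk_cost d (p @ r) = walk_cost d p + d (last p) (hd r) + walk_cost d r"
proof (induction p)
  case (Cons a p)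
  show ?case
  proof (cases p)
    case Nil
    then show ?thesis using Cons.prems by (cases r) auto
  next
    case (Cons b p')
    then show ?thesis using Cons.IH Cons.prems by simp
  qed
qed simp

lemma walk_cost_nonneg:
  "metric_on V d \<Longrightarrow> set w \<subseteq> V \<Longrightarrow> 0 \<le> walk_cost d w"
  by (induction d w rule: walk_cost.induct) (auto simp: metric_on_def)

lemma walk_cost_remove_node:
  assumes "metric_on V d" "set (p @ x # r) \<subseteq> V" "p \<noteq> []" "r \<noteq> []"
  shows "walk_cost d (p @ r) \<le> walk_cost d (p @ x # r)"
proof -
  have "last p \<in> V" "x \<in> V" "hd r \<in> V"
    using assms by (auto dest: last_in_set hd_in_set)
  then have "d (last p) (hd r) \<le> d (last p) x + d x (hd r)"
    using assms(1) unfolding metric_on_def by blast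
  moreover have "walk_cost d (x # r) = d x (hd r) + walk_cost d r"
    using assms(4) by (cases r) auto
  ultimately show ?thesis
    using walk_cost_append[of p r d] walk_cost_append[of p "x # r" d] assms(3,4) by simp
qed

lemma finite_vertices: "htap_instance I \<Longrightarrow> finite (vertices I)"
  by (simp add: htap_instance_def vertices_def)

lemma short_tour:
  assumes "htap_instance I" "is_tour I S w"
  shows "\<exists>w'. is_tour I S w' \<and> length w' \<le> Suc (card (vertices I)) \<and> tour_cost I w' \<le> tour_cost I w"
  using assms(2)
proof (induction "length w" arbitrary: w rule: less_induct)
  case less
  show ?case
  proof (cases "length w \<le> Suc (card (vertices I))")
    case False
    obtain s u where w: "w = s # u"
      using less.prems by (cases w) (auto simp: is_tour_def)
    have u: "set u \<subseteq> vertices I" "card (vertices I) < length u"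
      using less.prems False w by (auto simp: is_tour_def)
    have "\<not> distinct u"
    proof
      assume "distinct u"
      then have "length u \<le> card (vertices I)"
        using u(1) card_mono[OF finite_vertices[OF assms(1)]] by (metis distinct_card)
      then show False using u(2) by simp
    qed
    then obtain a x b c where abc: "u = a @ [x] @ b @ [x] @ c"
      using not_distinct_decomp by blast
    let ?w = "(s # a) @ (b @ x # c)"
    have weq: "w = (s # a) @ x # (b @ x # c)"
      using w abc by simp
    have t: "is_tour I S ?w"
      using less.prems unfolding weq is_tour_def by auto
    have m: "metric_on (vertices I) (distance I)"
      using assms(1) by (simp add: htap_instance_def)
    have "set ((s # a) @ x # (b @ x # c)) \<subseteq> vertices I"
      using less.prems unfolding weq is_tour_def by blast
    then have "tour_cost I ?w \<le> tour_cost I w"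
      unfolding weq using walk_cost_remove_node[OF m, of "s # a" x "b @ x # c"] by blast
    moreover have "length ?w < length w"
      unfolding weq by simp
    ultimately show ?thesis
      using less.hyps[OF _ t] order_trans by meson
  qed (use less.prems in blast)
qed

lemma min_tour_cost_attained:
  assumes "htap_instance I" "S \<subseteq> vertices I"
  shows "\<exists>w. is_tour I S w \<and> tour_cost I w = min_tour_cost I S"
    and "is_tour I S w \<Longrightarrow> min_tour_cost I S \<le> tour_cost I w"
proof -
  let ?C = "{tour_cost I w | w. is_tour I S w}"
  let ?F = "{w. set w \<subseteq> vertices I \<and> length w \<le> Suc (card (vertices I))}"
  let ?D = "tour_cost I ` {w \<in> ?F. is_tour I S w}"
  have "finite ?F"
    using finite_lists_length_le finite_vertices[OF assms(1)] by blast
  then have fin: "finite ?D" using finite_subset[of "{w \<in> ?F. is_tour I S w}" ?F] by blast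
  obtain vs where vs: "set vs = S"
    using finite_list assms(2) finite_vertices[OF assms(1)] finite_subset by metis
  have "is_tour I S (depot I # vs @ [depot I])"
    using vs assms(2) by (auto simp: is_tour_def vertices_def)
  then obtain w0 where w0: "is_tour I S w0" "length w0 \<le> Suc (card (vertices I))"
    using short_tour[OF assms(1)] by blast
  then have ne: "?D \<noteq> {}"
    by (auto simp: is_tour_def)
  have low: "Min ?D \<le> tour_cost I w" if w: "is_tour I S w" for w
  proof -
    obtain w' where "is_tour I S w'" "length w' \<le> Suc (card (vertices I))"
        "tour_cost I w' \<le> tour_cost I w"
      using short_tour[OF assms(1) w] by blast
    moreover from this have "Min ?D \<le> tour_cost I w'"
      by (intro Min_le[OF fin]) (auto simp: is_tour_def)
    ultimately show ?thesis by simp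
  qed
  have "Min ?D \<in> ?D"
    using Min_in[OF fin ne] .
  then obtain w1 where w1: "is_tour I S w1" "tour_cost I w1 = Min ?D" by auto
  have "min_tour_cost I S = Min ?D"
    unfolding min_tour_cost_def
  proof (rule cInf_eq_minimum)
    show "Min ?D \<in> ?C" using w1 by force
  qed (use low in blast)
  then show "\<exists>w. is_tour I S w \<and> tour_cost I w = min_tour_cost I S"
    and "is_tour I S w \<Longrightarrow> min_tour_cost I S \<le> tour_cost I w"
    using w1 low by auto
qed

lemma htap_opt_attained:
  assumes "htap_instance I"
  shows "\<exists>S. allocation I S \<and>
           htap_opt I = Max ((\<lambda>j. min_tour_cost I (S j)) ` {..<n_agents I})"
    and "allocation I S \<Longrightarrow>
           htap_opt I \<le> Max ((\<lambda>j. min_tour_cost I (S j)) ` {..<n_agents I})"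
proof -
  let ?M = "\<lambda>S. Max ((\<lambda>j. min_tour_cost I (S j)) ` {..<n_agents I})"
  let ?O = "{?M S | S. allocation I S}"
  have k: "{..<n_agents I} \<noteq> {}"
    using assms by (auto simp: htap_instance_def lessThan_empty_iff)
  have "?O \<subseteq> min_tour_cost I ` Pow (all_tasks I)"
  proof
    fix x assume "x \<in> ?O"
    then obtain S where S: "allocation I S" "x = ?M S" by auto
    have "x \<in> (\<lambda>j. min_tour_cost I (S j)) ` {..<n_agents I}"
      unfolding S(2) by (rule Max_in) (use k in auto)
    then obtain j where "j < n_agents I" "x = min_tour_cost I (S j)" by auto
    moreover have "S j \<subseteq> all_tasks I"
      using S(1) \<open>j < n_agents I\<close> by (auto simp: allocation_def)
    ultimately show "x \<in> min_tour_cost I ` Pow (all_tasks I)" by blast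
  qed
  moreover have "finite (min_tour_cost I ` Pow (all_tasks I))"
    using assms by (simp add: htap_instance_def)
  ultimately have fin: "finite ?O"
    by (rule finite_subset)
  have type: "agent_type I j \<in> {1..n_types I}" if "j < n_agents I" for j
    using assms that by (auto simp: htap_instance_def)
  have "allocation I (\<lambda>j. tasks I (agent_type I j) \<union> tasks I 0)"
    unfolding allocation_def
  proof (intro conjI exI allI impI)
    show "(\<Union>j<n_agents I. tasks I (agent_type I j) \<union> tasks I 0) = all_tasks I" (is "?L = _")
    proof (intro equalityI subsetI)
      fix x assume "x \<in> ?L"
      then show "x \<in> all_tasks I"
        using type by (fastforce simp: all_tasks_def)
    next
      fix x assume "x \<in> all_tasks I"
      then obtain i where i: "i \<le> n_types I" "x \<in> tasks I i"
        by (auto simp: all_tasks_def)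
      show "x \<in> ?L"
      proof (cases "i = 0")
        case True
        then show ?thesis using i k by blast
      next
        case False
        then have "1 \<le> type_count I i"
          using i assms by (auto simp: htap_instance_def)
        then have "{j. j < n_agents I \<and> agent_type I j = i} \<noteq> {}"
          unfolding type_count_def by (metis card.empty not_one_le_zero)
        then show ?thesis using i by blast
      qed
    qed
  qed auto
  then have ne: "?O \<noteq> {}" by blast
  show "\<exists>S. allocation I S \<and> htap_opt I = ?M S"
    using Min_in[OF fin ne] unfolding htap_opt_def by blast
  show "htap_opt I \<le> ?M S" if "allocation I S" for S
    unfolding htap_opt_def by (rule Min_le[OF fin]) (use that in blast)
qed

lemma min_tour_cost_empty:
  assumes "htap_instance I"
  shows "min_tour_cost I {} = 0"
proof (rule antisym)
  have "is_tour I {} [depot I]"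
    by (simp add: is_tour_def vertices_def)
  then show "min_tour_cost I {} \<le> 0"
    using min_tour_cost_attained(2)[OF assms, of "{}" "[depot I]"] by simp
  obtain w where "is_tour I {} w" "tour_cost I w = min_tour_cost I {}"
    using min_tour_cost_attained(1)[OF assms, of "{}"] by blast
  then show "0 \<le> min_tour_cost I {}"
    using walk_cost_nonneg[of "vertices I" "distance I" w] assms
    by (auto simp: is_tour_def htap_instance_def)
qed

section \<open>The value computed by SPLITOUR\<close>

lemma fst_return [simp]: "fst (timed_return x) = x"
  and snd_return [simp]: "snd (timed_return x) = 0"
  by (simp_all add: timed_return_def)

lemma fst_bind [simp]: "fst (timed_bind c f) = fst (f (fst c))"
  and snd_bind [simp]: "snd (timed_bind c f) = snd c + snd (f (fst c))"
  by (simp_all add: timed_bind_def)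

lemma snd_tick [simp]: "snd tick = 1"
  by (simp add: tick_def)

lemma fst_walk_cost_t: "fst (walk_cost_t d w) = walk_cost d w"
  by (induction d w rule: walk_cost.induct) auto

lemma fst_max_dist_t:
  "fst (max_dist_t d s vs) = Max (insert 0 (d s ` set vs))"
proof (induction vs)
  case (Cons v vs)
  have "Max (insert 0 (d s ` set (v # vs))) = Max (insert (d s v) (insert 0 (d s ` set vs)))"
    by (simp add: insert_commute)
  also have "\<dots> = max (d s v) (Max (insert 0 (d s ` set vs)))"
    by (rule Max_insert) auto
  finally show ?case using Cons by simp
qed simp

lemma fst_enum_t: "fst (enum_t i n) = [i..<i + n]"
  by (induction i n rule: enum_t.induct) (simp_all add: upt_rec)

lemma fst_map_t: "fst (map_t f xs) = map (fst \<circ> f) xs"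
  by (induction xs) auto

lemma fst_subtours_t:
  "fst (subtours_t vs ps) =
     map (\<lambda>j. hd vs # drop (ps ! j) (take (ps ! Suc j) vs) @ [hd vs]) [0..<length ps - 1]"
proof (induction vs ps rule: subtours_t.induct)
  case (1 vs p p' ps)
  have "[0..<length (p # p' # ps) - 1] = 0 # map Suc [0..<length (p' # ps) - 1]"
    by (simp add: map_Suc_upt upt_conv_Cons del: upt_Suc)
  then show ?case
    using 1 by (simp add: take_t_def drop_t_def append_t_def del: upt_Suc)
qed auto

lemma fst_last_within_t:
  "p \<le> i \<Longrightarrow> fst (last_within_t d b i p c u vs) =
     Max (insert p {i + l | l. l \<in> {1..length vs} \<and> c + walk_cost d (take (Suc l) (u # vs)) \<le> b})"
proof (induction vs arbitrary: i p c u)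
  case (Cons v vs)
  let ?p = "if c + d u v \<le> b then Suc i else p"
  let ?A = "{i + l | l. l \<in> {1..length (v # vs)} \<and> c + walk_cost d (take (Suc l) (u # v # vs)) \<le> b}"
  let ?B = "{Suc i + l | l. l \<in> {1..length vs} \<and>
              c + d u v + walk_cost d (take (Suc l) (v # vs)) \<le> b}"
  have A: "?A = (if c + d u v \<le> b then {Suc i} else {}) \<union> ?B" (is "_ = ?R")
  proof (intro equalityI subsetI)
    fix x assume "x \<in> ?A"
    then obtain l where l: "x = i + l" "1 \<le> l" "l \<le> Suc (length vs)"
        "c + walk_cost d (take (Suc l) (u # v # vs)) \<le> b" by auto
    show "x \<in> ?R"
    proof (cases "l = 1")
      case False
      then obtain l' where "l = Suc l'" "1 \<le> l'" using l(2) by (cases l) auto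
      then have "x \<in> ?B" using l by (auto intro!: exI[of _ l'])
      then show ?thesis by blast
    qed (use l in auto)
  next
    fix x assume "x \<in> ?R"
    then consider "x = Suc i" "c + d u v \<le> b" | "x \<in> ?B" by (auto split: if_splits)
    then show "x \<in> ?A"
    proof cases
      case 1
      then show ?thesis by (auto intro!: exI[of _ 1])
    next
      case 2
      then obtain l where "x = Suc i + l" "1 \<le> l" "l \<le> length vs"
        "c + d u v + walk_cost d (take (Suc l) (v # vs)) \<le> b" by auto
      then show ?thesis by (auto intro!: exI[of _ "Suc l"] simp: add.assoc)
    qed
  qed
  have fin: "finite ?B" by simp
  have "Max (insert p ?A) = Max (insert ?p ?B)"
  proof (cases "c + d u v \<le> b")
    case True
    have 1: "Max (insert p (insert (Suc i) ?B)) = max p (Max (insert (Suc i) ?B))"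
      using fin by (intro Max_insert) auto
    have "Suc i \<le> Max (insert (Suc i) ?B)"
      using fin by (intro Max_ge) auto
    then have 2: "max p (Max (insert (Suc i) ?B)) = Max (insert (Suc i) ?B)"
      using Cons.prems by (intro max.absorb2) linarith
    have 3: "insert p ?A = insert p (insert (Suc i) ?B)"
      unfolding A using True by simp
    have "Max (insert p ?A) = Max (insert (Suc i) ?B)"
      unfolding 3 1 2 by (rule refl)
    then show ?thesis using True by (simp only: if_True)
  next
    case False
    then have "insert p ?A = insert ?p ?B"
      unfolding A by simp
    then show ?thesis by (rule arg_cong)
  qed
  moreover have "fst (last_within_t d b i p c u (v # vs)) = Max (insert ?p ?B)"
    using Cons.IH[of ?p "Suc i" "c + d u v" v] Cons.prems by simp
  ultimately show ?case by presburger
qed simp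

lemma fst_split_point_t:
  assumes "vs \<noteq> []" "0 \<le> b"
  shows "fst (split_point_t d b vs) = Max {i \<in> {1..length vs}. walk_cost d (take i vs) \<le> b}"
proof -
  obtain u us where vs: "vs = u # us" using assms(1) by (cases vs) auto
  have "insert 1 {1 + l | l. l \<in> {1..length us} \<and> 0 + walk_cost d (take (Suc l) (u # us)) \<le> b}
      = {i \<in> {1..length vs}. walk_cost d (take i vs) \<le> b}" (is "?L = ?R")
  proof (intro equalityI subsetI)
    fix x assume x: "x \<in> ?R"
    show "x \<in> ?L"
    proof (cases "x = 1")
      case False
      then obtain l where "x = Suc l" "1 \<le> l" using x by (cases x) auto
      then show ?thesis using x vs by auto
    qed simp
  qed (use vs assms(2) in auto)
  then show ?thesis
    using fst_last_within_t[of 1 1 d b 0 u us] by (simp add: split_point_t_def vs)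
qed

lemma distance_le_walk_cost:
  "metric_on V d \<Longrightarrow> w \<noteq> [] \<Longrightarrow> set w \<subseteq> V \<Longrightarrow> d (hd w) (last w) \<le> walk_cost d w"
proof (induction w rule: induct_list012)
  case (3 u v w)
  have "u \<in> V" "v \<in> V" "last (v # w) \<in> V"
    using 3(5) last_in_set[of "v # w"] by auto
  then have "d u (last (v # w)) \<le> d u v + d v (last (v # w))"
    using 3(3) unfolding metric_on_def by blast
  then show ?case using 3 by fastforce
qed (auto simp: metric_on_def)

lemma twice_max_dist_le_cost:
  assumes m: "metric_on V d" and vs: "set vs \<subseteq> V" "vs \<noteq> []"
  shows "2 * Max (insert 0 (d (hd vs) ` set (tl vs))) \<le> walk_cost d (vs @ [hd vs])"
proof -
  obtain s us where s: "vs = s # us" using vs by (cases vs) auto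
  have "2 * d s v \<le> walk_cost d (vs @ [s])" if v: "v \<in> set us" for v
  proof -
    obtain a b where ab: "us = a @ v # b" using v by (meson split_list)
    have "walk_cost d (vs @ [s]) = walk_cost d ((s # a) @ [v]) + walk_cost d (v # b @ [s])"
      using walk_cost_append[of "s # a" "v # b @ [s]" d] walk_cost_append[of "s # a" "[v]" d]
      by (simp add: s ab)
    moreover have "d s v \<le> walk_cost d ((s # a) @ [v])"
      using distance_le_walk_cost[OF m, of "(s # a) @ [v]"] vs by (simp add: s ab)
    moreover have "d v s \<le> walk_cost d (v # b @ [s])"
      using distance_le_walk_cost[OF m, of "v # b @ [s]"] vs by (simp add: s ab)
    moreover have "d v s = d s v"
      using m vs v unfolding metric_on_def s by auto
    ultimately show ?thesis by linarith
  qed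
  moreover have "0 \<le> walk_cost d (vs @ [s])"
    using walk_cost_nonneg[OF m, of "vs @ [s]"] vs s by simp
  moreover have "Max (insert 0 (d s ` set us)) \<in> insert 0 (d s ` set us)"
    by (rule Max_in) auto
  ultimately show ?thesis by (auto simp: s)
qed

text \<open>The subtours returned by \<open>splitour\<close>, with \<open>p(j)\<close> in closed form. The boundary cases
  \<open>p(0) = 1\<close> and \<open>p(q) = n\<close> give the first and the last subtour.\<close>

lemma fst_splitour:
  assumes "metric_on V d" "set vs \<subseteq> V" "vs \<noteq> []" "1 \<le> q"
  defines "L \<equiv> walk_cost d (vs @ [hd vs])"
    and "cmax \<equiv> Max (insert 0 (d (hd vs) ` set (tl vs)))"
  defines "p \<equiv> \<lambda>j. if j = 0 then 1 else if j = q then length vs else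
     Max {i \<in> {1..length vs}.
            walk_cost d (take i vs) \<le> real j / real q * (L - 2 * cmax) + cmax}"
  shows "fst (splitour d vs q) =
           map (\<lambda>j. hd vs # drop (p (j - 1)) (take (p j) vs) @ [hd vs]) [1..<Suc q]"
proof -
  let ?b = "\<lambda>j. real j / real q * (L - 2 * cmax) + cmax"
  have c: "0 \<le> cmax" unfolding cmax_def by (rule Max_ge) auto
  have "2 * cmax \<le> L"
    unfolding cmax_def L_def using twice_max_dist_le_cost assms(1-3) by blast
  then have b: "0 \<le> ?b j" for j using c by simp
  define ps where "ps = 1 # map (\<lambda>j. fst (split_point_t d (?b j) vs)) [1..<q] @ [length vs]"
  have q: "Suc (q - Suc 0) = q" using assms(4) by simp
  have "fst (splitour d vs q) = fst (subtours_t vs ps)"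
    by (simp add: splitour_def append_t_def length_t_def fst_walk_cost_t fst_max_dist_t
        fst_map_t fst_enum_t ps_def L_def cmax_def comp_def q del: upt_Suc)
  moreover have "ps = map p [0..<Suc q]"
  proof (rule nth_equalityI)
    show len: "length ps = length (map p [0..<Suc q])"
      using assms(4) by (simp add: ps_def)
    fix j assume "j < length ps"
    then have j: "j \<le> q" using len by simp
    consider "j = 0" | "0 < j" "j < q" | "j = q" "0 < j" using j by linarith
    then show "ps ! j = map p [0..<Suc q] ! j"
    proof cases
      case 1
      then show ?thesis by (simp add: ps_def p_def del: upt_Suc)
    next
      case 2
      then obtain i where i: "j = Suc i" "i < q - 1" by (cases j) auto
      then have "ps ! j = fst (split_point_t d (?b j) vs)"
        by (simp add: ps_def nth_append)
      moreover have "map p [0..<Suc q] ! j = p j"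
        using j by (simp del: upt_Suc)
      ultimately show ?thesis
        using 2 fst_split_point_t[OF assms(3) b] by (simp add: p_def)
    next
      case 3
      then have "ps ! j = length vs"
        by (simp add: ps_def nth_append)
      moreover have "map p [0..<Suc q] ! j = p j"
        using j by (simp del: upt_Suc)
      ultimately show ?thesis
        using 3 by (simp add: p_def)
    qed
  qed
  moreover have "[1..<Suc q] = map Suc [0..<q]"
    by (simp add: map_Suc_upt)
  ultimately show ?thesis
    by (simp add: fst_subtours_t comp_def del: upt_Suc)
qed

end

theory Submission
  imports Defs "HOL-Library.Sublist"
begin

text \<open>With one agent per type, each agent must perform all its type-specific tasks in any allocation,
  so its Christofides tour costs at most \<open>3/2 * opt\<close>. Concatenating the optimal tours of all agents
  visits \<open>T\<^sub>0\<close>, hence the Christofides tour on \<open>T\<^sub>0\<close> has cost \<open>L \<le> 3/2 * k * opt\<close>. Every generic task lies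
  on the optimal tour of some agent, hence \<open>2 * cmax \<le> opt\<close>. Every subtour of SPLITOUR costs at most
  \<open>L/k + 2 * cmax * (1 - 1/k)\<close>, because its inner part is a piece of the tour of cost at most
  \<open>(L - 2 * cmax)/k\<close> and each edge from or to the depot costs at most \<open>cmax\<close>. Adding the two
  subtours of an agent gives \<open>3/2 + 3/2 + 1 - 1/k\<close> times the optimum.

  For Christofides' bound, an arbitrary closed walk is shortcut to a Hamiltonian cycle on all nodes,
  which contains a spanning tree, and to one on the odd nodes of the spanning tree, which is the
  union of two perfect matchings; the number of odd nodes is even since they have a perfect
  matching by assumption.\<close>

section \<open>Shortcutting walks\<close>

text \<open>The triangle inequality pays for removing a node between two others, nonnegativity for
  removing the last one. The common first node \<open>u\<close> guarantees that every removed node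
  has a predecessor.\<close>

lemma walk_cost_subseq_Cons:
  assumes "metric_on V d" "subseq xs ys" "set (u # ys) \<subseteq> V"
  shows "walk_cost d (u # xs) \<le> walk_cost d (u # ys)"
  using assms(2,3)
proof (induction arbitrary: u)
  case (list_emb_Nil ys)
  then show ?case
    using walk_cost_nonneg[OF assms(1), of "u # ys"] by simp
next
  case (list_emb_Cons xs ys y)
  have "walk_cost d (u # ys) \<le> walk_cost d (u # y # ys)"
  proof (cases "ys = []")
    case True
    then show ?thesis
      using walk_cost_nonneg[OF assms(1), of "u # y # ys"] list_emb_Cons.prems by simp
  next
    case False
    then show ?thesis
      using walk_cost_remove_node[OF assms(1), of "[u]" y ys] list_emb_Cons.prems by simp
  qed
  then show ?case
    using list_emb_Cons.IH[of u] list_emb_Cons.prems by fastforce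
next
  case (list_emb_Cons2 x y xs ys)
  then show ?case by simp
qed

lemma walk_cost_subseq:
  assumes "metric_on V d" "subseq xs ys" "set ys \<subseteq> V"
  shows "walk_cost d xs \<le> walk_cost d ys"
  using assms(2,3)
proof induction
  case (list_emb_Nil ys)
  then show ?case
    using walk_cost_nonneg[OF assms(1), of ys] by simp
next
  case (list_emb_Cons xs ys y)
  have "walk_cost d ys \<le> walk_cost d (y # ys)"
    using assms(1) list_emb_Cons.prems by (cases ys) (auto simp: metric_on_def)
  then show ?case
    using list_emb_Cons by auto
next
  case (list_emb_Cons2 x y xs ys)
  then show ?case using walk_cost_subseq_Cons[OF assms(1), of xs ys y] by simp
qed

lemma subseq_remdups: "subseq (remdups xs) xs"
  by (induction xs) auto

text \<open>This is the shortcut in Christofides' algorithm: as a subsequence, the shortened walk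
  costs no more than the circuit.\<close>

lemma subseq_first_occurrences: "subseq (rev (remdups (rev xs))) xs"
  by (induction xs rule: rev_induct) (auto intro: subseq_rev_drop_many)

lemma walk_cost_close:
  assumes "metric_on V d" "w \<noteq> []" "hd w = s" "last w = s" "s \<in> V"
  shows "walk_cost d (w @ [s]) = walk_cost d w"
  using assms walk_cost_append[of w "[s]" d] by (simp add: metric_on_def)

text \<open>The set \<open>U\<close> may miss \<open>s\<close>, as the odd nodes of a tree can. The
  nodes of \<open>U\<close> are therefore first visited between two copies of \<open>s\<close>; the
  passage through \<open>s\<close> is then replaced by a direct closing edge.\<close>

lemma shortcut_closed_walk:
  assumes m: "metric_on V d" and w: "w \<noteq> []" "hd w = s" "last w = s" "set w \<subseteq> V"
    and U: "U \<subseteq> set w" "U \<noteq> {}"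
  obtains xs where "distinct xs" "set xs = U" "xs \<noteq> []" "walk_cost d (xs @ [hd xs]) \<le> walk_cost d w"
proof
  define xs where "xs = remdups (filter (\<lambda>v. v \<in> U) w)"
  have s: "s \<in> V" using w by auto
  show "distinct xs" "set xs = U" using U by (auto simp: xs_def)
  then show ne: "xs \<noteq> []" using U(2) by auto
  have sub: "set xs \<subseteq> V" using \<open>set xs = U\<close> U w by auto
  have "hd xs \<in> V" "last xs \<in> V" using ne sub by auto
  then have tri: "d (last xs) (hd xs) \<le> d (last xs) s + d s (hd xs)"
    using m s unfolding metric_on_def by blast
  have "subseq xs w"
    unfolding xs_def by (meson subseq_filter_left subseq_order.trans subseq_remdups)
  \<comment> \<open>Since \<open>w\<close> starts and ends at \<open>s\<close>, padding it with
    \<open>s\<close> on both sides adds only loops of cost 0.\<close>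
  then have "subseq (s # xs @ [s]) (s # w @ [s])"
    by (simp add: list_emb_append_mono)
  then have "walk_cost d (s # xs @ [s]) \<le> walk_cost d (s # w @ [s])"
    using w s by (intro walk_cost_subseq[OF m]) auto
  also have "\<dots> = walk_cost d w"
    using walk_cost_close[OF m w(1,2,3) s] w m s by (cases w) (auto simp: metric_on_def)
  finally have "walk_cost d (s # xs @ [s]) \<le> walk_cost d w" .
  moreover have "walk_cost d (s # xs @ [s]) = d s (hd xs) + walk_cost d xs + d (last xs) s"
    using ne walk_cost_append[of xs "[s]" d] by (cases xs) auto
  moreover have "walk_cost d (xs @ [hd xs]) = walk_cost d xs + d (last xs) (hd xs)"
    using ne walk_cost_append[of xs "[hd xs]" d] by simp
  ultimately show "walk_cost d (xs @ [hd xs]) \<le> walk_cost d w" using tri by linarith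
qed

section \<open>Edges of walks\<close>

text \<open>The description in \<open>edge_weight\<close> is unique because the set
  \<open>{u, v}\<close> leaves only two orders of its nodes, and \<open>d\<close> is
  symmetric.\<close>

lemma edge_weight_doubleton:
  assumes "metric_on V d" "u \<in> V" "v \<in> V"
  shows "edge_weight d {u, v} = d u v"
  unfolding edge_weight_def
proof (rule the_equality)
  fix x assume "\<exists>a b. {u, v} = {a, b} \<and> x = d a b"
  then show "x = d u v"
    using assms by (auto simp: metric_on_def doubleton_eq_iff)
qed blast

lemma doubleton_in_edges_on_iff: "{u, v} \<in> edges_on V \<longleftrightarrow> u \<in> V \<and> v \<in> V \<and> u \<noteq> v"
  unfolding edges_on_def by (auto simp: doubleton_eq_iff)

lemma edges_on_mono: "U \<subseteq> V \<Longrightarrow> edges_on U \<subseteq> edges_on V"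
  unfolding edges_on_def by blast

lemma Union_edges_on_subset: "\<Union> (edges_on V) \<subseteq> V"
  unfolding edges_on_def by blast

lemma walk_edges_Cons: "walk_edges (u # v # w) = {u, v} # walk_edges (v # w)"
  by (simp add: walk_edges_def)

lemma walk_edges_short [simp]: "walk_edges [] = []" "walk_edges [u] = []"
  by (simp_all add: walk_edges_def)

lemma walk_cost_eq_sum_edge_weights:
  assumes "metric_on V d" "set w \<subseteq> V"
  shows "walk_cost d w = sum_mset (image_mset (edge_weight d) (mset (walk_edges w)))"
  using assms(2)
  by (induction w rule: induct_list012)
     (simp_all add: walk_edges_Cons edge_weight_doubleton[OF assms(1)])

lemma Union_walk_edges_subset: "\<Union> (set (walk_edges w)) \<subseteq> set w"
  by (induction w rule: induct_list012) (auto simp: walk_edges_Cons)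

lemma nth_edge_in_walk_edges:
  "Suc i < length w \<Longrightarrow> {w ! i, w ! Suc i} \<in> set (walk_edges w)"
proof (induction w arbitrary: i rule: induct_list012)
  case (3 u v w)
  then show ?case by (cases i) (auto simp: walk_edges_Cons)
qed auto

text \<open>The first node never returns, so its edge is new. Distinctness turns sums along a path
  into sums over its edge set.\<close>

lemma distinct_walk_edges: "distinct w \<Longrightarrow> distinct (walk_edges w)"
proof (induction w rule: induct_list012)
  case (3 u v w)
  have "{u, v} \<notin> set (walk_edges (v # w))"
    using 3(3) Union_walk_edges_subset[of "v # w"] by auto
  then show ?case using 3 by (auto simp: walk_edges_Cons)
qed auto

text \<open>These are the cyclic predecessor and successor of \<open>x\<close>; length at least 3
  keeps them apart.\<close>

lemma cycle_neighbours:
  assumes "3 \<le> length c" "distinct c" "x \<in> set c"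
  obtains y z where "y \<noteq> z" "y \<noteq> x" "z \<noteq> x"
    "{x, y} \<in> set (walk_edges (c @ [hd c]))" "{x, z} \<in> set (walk_edges (c @ [hd c]))"
proof -
  let ?w = "c @ [hd c]" and ?n = "length c"
  obtain i where i: "i < ?n" "c ! i = x" using assms(3) by (metis in_set_conv_nth)
  have ne: "c \<noteq> []" using assms(1) by auto
  then have hd: "hd c = c ! 0" by (rule hd_conv_nth)
  have succ: "{x, ?w ! Suc i} \<in> set (walk_edges ?w)"
    using nth_edge_in_walk_edges[of i ?w] i by (simp add: nth_append)
  show ?thesis
  proof (cases i)
    case 0
    \<comment> \<open>The predecessor of the first node is the last one, across the closing
      edge.\<close>
    have "{?w ! (?n - 1), ?w ! Suc (?n - 1)} \<in> set (walk_edges ?w)"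
      using assms(1) by (intro nth_edge_in_walk_edges) simp
    moreover have "?w ! (?n - 1) = c ! (?n - 1)" "?w ! Suc (?n - 1) = x"
      using assms(1) 0 i hd by (auto simp: nth_append)
    ultimately have "{x, c ! (?n - 1)} \<in> set (walk_edges ?w)"
      by (simp add: insert_commute)
    moreover have "{x, c ! 1} \<in> set (walk_edges ?w)"
      using succ 0 assms(1) by (simp add: nth_append)
    moreover have "c ! 1 \<noteq> c ! (?n - 1)" "c ! 1 \<noteq> x" "c ! (?n - 1) \<noteq> x"
      using assms(1,2) i 0 by (auto simp: nth_eq_iff_index_eq)
    ultimately show ?thesis using that by blast
  next
    case (Suc j)
    have "{?w ! j, ?w ! Suc j} \<in> set (walk_edges ?w)"
      using Suc i by (intro nth_edge_in_walk_edges) simp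
    then have "{x, c ! j} \<in> set (walk_edges ?w)"
      using Suc i by (simp add: nth_append insert_commute)
    moreover have "?w ! Suc i \<noteq> c ! j" "?w ! Suc i \<noteq> x" "c ! j \<noteq> x"
      using assms(1,2) i Suc hd ne by (auto simp: nth_append nth_eq_iff_index_eq)
    ultimately show ?thesis using that succ by blast
  qed
qed

lemma acyclic_graph_empty: "acyclic_graph ({} :: 'a set set)"
proof -
  have "set (walk_edges (c @ [hd c])) \<noteq> {}" if "3 \<le> length c" for c :: "'a list"
    using nth_edge_in_walk_edges[of 0 "c @ [hd c]"] that by (cases c) auto
  then show ?thesis unfolding acyclic_graph_def subset_empty by blast
qed

text \<open>A node on a cycle has two different neighbours there, but \<open>x\<close> is adjacent
  to \<open>y\<close> alone. So no cycle passes through \<open>x\<close>, and none uses the new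
  edge.\<close>

lemma acyclic_graph_insert_leaf:
  assumes "acyclic_graph E" "x \<notin> \<Union> E"
  shows "acyclic_graph (insert {x, y} E)"
  unfolding acyclic_graph_def
proof
  assume "\<exists>c. 3 \<le> length c \<and> distinct c \<and> set (walk_edges (c @ [hd c])) \<subseteq> insert {x, y} E"
  then obtain c where c: "3 \<le> length c" "distinct c"
    "set (walk_edges (c @ [hd c])) \<subseteq> insert {x, y} E" by blast
  have "x \<notin> set c"
  proof
    assume "x \<in> set c"
    then obtain a b where ab: "a \<noteq> b" "a \<noteq> x" "b \<noteq> x"
      "{x, a} \<in> set (walk_edges (c @ [hd c]))" "{x, b} \<in> set (walk_edges (c @ [hd c]))"
      using cycle_neighbours[OF c(1,2)] by blast
    then have "{x, a} \<in> insert {x, y} E" "{x, b} \<in> insert {x, y} E"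
      using c(3) by blast+
    then have "{x, a} = {x, y}" "{x, b} = {x, y}" using assms(2) by blast+
    then show False using ab by (auto simp: doubleton_eq_iff)
  qed
  moreover have "set (c @ [hd c]) = set c" using c(1) by (cases c) auto
  ultimately have "{x, y} \<notin> set (walk_edges (c @ [hd c]))"
    using Union_walk_edges_subset[of "c @ [hd c]"] by auto
  then show False using c assms(1) unfolding acyclic_graph_def by blast
qed

text \<open>Each node put in front of the path is a leaf attached to the old first node. That node
  is a hub: all others are connected to it, hence to each other.\<close>

lemma spanning_tree_path:
  "distinct xs \<Longrightarrow> spanning_tree (set xs) (set (walk_edges xs))"
proof (induction xs rule: induct_list012)
  case (3 x y r)
  let ?E = "set (walk_edges (y # r))" and ?E' = "set (walk_edges (x # y # r))"
  let ?R = "{(a, b). {a, b} \<in> ?E'}\<^sup>*"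
  have IH: "spanning_tree (set (y # r)) ?E" using 3 by simp
  have E': "?E' = insert {x, y} ?E" by (simp add: walk_edges_Cons)
  have "x \<notin> \<Union> ?E"
    using 3(3) Union_walk_edges_subset[of "y # r"] by auto
  then have "acyclic_graph ?E'"
    unfolding E' using IH by (intro acyclic_graph_insert_leaf) (simp add: spanning_tree_def)
  moreover have "?E' \<subseteq> edges_on (set (x # y # r))"
  proof -
    have "{x, y} \<in> edges_on (set (x # y # r))"
      using 3(3) by (simp add: doubleton_in_edges_on_iff)
    moreover have "edges_on (set (y # r)) \<subseteq> edges_on (set (x # y # r))"
      by (rule edges_on_mono) auto
    ultimately show ?thesis
      using IH unfolding E' spanning_tree_def by blast
  qed
  moreover have "connected_graph (set (x # y # r)) ?E'"
  proof -
    have "sym {(a, b). {a, b} \<in> ?E'}" by (auto simp: sym_def insert_commute)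
    then have sym: "(b, a) \<in> ?R" if "(a, b) \<in> ?R" for a b
      using that by (meson sym_rtrancl symD)
    have xy: "(x, y) \<in> ?R" by (auto simp: E')
    have "{(a, b). {a, b} \<in> ?E}\<^sup>* \<subseteq> ?R"
      by (intro rtrancl_mono) (auto simp: E')
    then have "(y, v) \<in> ?R" if "v \<in> set (y # r)" for v
      using IH that unfolding spanning_tree_def connected_graph_def by (meson list.set_intros(1) subsetD)
    then have "(y, v) \<in> ?R" if "v \<in> set (x # y # r)" for v
      using that sym[OF xy] by auto
    then show ?thesis
      unfolding connected_graph_def using sym by (meson rtrancl_trans)
  qed
  ultimately show ?case by (simp add: spanning_tree_def)
qed (use acyclic_graph_empty in \<open>auto simp: spanning_tree_def connected_graph_def\<close>)

text \<open>After shortcutting to a cycle on \<open>U\<close>, leaving out the closing edge gives a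
  path, which is a competing spanning tree.\<close>

lemma min_spanning_tree_le_closed_walk:
  assumes m: "metric_on V d" and T: "min_spanning_tree d U E"
    and w: "w \<noteq> []" "hd w = s" "last w = s" "set w \<subseteq> V" and U: "U \<subseteq> set w" "U \<noteq> {}"
  shows "sum (edge_weight d) E \<le> walk_cost d w"
proof -
  obtain xs where xs: "distinct xs" "set xs = U" "xs \<noteq> []"
    "walk_cost d (xs @ [hd xs]) \<le> walk_cost d w"
    using shortcut_closed_walk[OF m w U] .
  have sub: "set (xs @ [hd xs]) \<subseteq> V" using xs(2,3) U w(4) hd_in_set[of xs] by fastforce
  have "sum (edge_weight d) E \<le> sum (edge_weight d) (set (walk_edges xs))"
    using T spanning_tree_path[OF xs(1)] xs(2) unfolding min_spanning_tree_def by blast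
  also have "\<dots> = walk_cost d xs"
    using walk_cost_eq_sum_edge_weights[OF m, of xs] sub distinct_walk_edges[OF xs(1)]
    by (simp add: sum_list_distinct_conv_sum_set sum_mset_sum_list flip: mset_map)
  also have "\<dots> \<le> walk_cost d (xs @ [hd xs])"
    using sub by (intro walk_cost_subseq[OF m]) auto
  finally show ?thesis using xs(4) by simp
qed

section \<open>Alternating matchings of a Hamiltonian cycle\<close>

fun alternate_edges :: "'a list \<Rightarrow> 'a set list" where
  "alternate_edges (u # v # w) = {u, v} # alternate_edges w"
| "alternate_edges _ = []"

lemma perfect_matching_alternate_edges:
  "distinct xs \<Longrightarrow> even (length xs) \<Longrightarrow>
     perfect_matching (set xs) (set (alternate_edges xs)) \<and> distinct (alternate_edges xs)"
proof (induction xs rule: alternate_edges.induct)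
  case (1 u v w)
  let ?M = "set (alternate_edges w)"
  have IH: "perfect_matching (set w) ?M" "distinct (alternate_edges w)" using 1 by auto
  have sub: "\<Union> ?M \<subseteq> set w"
    using IH(1) Union_edges_on_subset[of "set w"] unfolding perfect_matching_def by blast
  have uv: "u \<notin> set w" "v \<notin> set w" "u \<noteq> v" using 1(2) by auto
  have "edges_on (set w) \<subseteq> edges_on (set (u # v # w))"
    by (rule edges_on_mono) auto
  then have "?M \<subseteq> edges_on (set (u # v # w))"
    using IH(1) unfolding perfect_matching_def by blast
  then have "insert {u, v} ?M \<subseteq> edges_on (set (u # v # w))"
    using uv by (simp add: doubleton_in_edges_on_iff)
  moreover have "\<exists>!e. e \<in> insert {u, v} ?M \<and> x \<in> e" if x: "x \<in> set (u # v # w)" for x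
  proof (cases "x \<in> {u, v}")
    case True
    then have "x \<notin> \<Union> ?M" using sub uv by auto
    then show ?thesis using True by blast
  next
    case False
    then have "\<exists>!e. e \<in> ?M \<and> x \<in> e"
      using x IH(1) unfolding perfect_matching_def by simp
    then show ?thesis using False by blast
  qed
  moreover have "{u, v} \<notin> ?M" using sub uv by blast
  ultimately show ?case using IH(2) by (simp add: perfect_matching_def)
qed (auto simp: perfect_matching_def)

text \<open>Applied to a closed walk \<open>u # w\<close> with an even number of edges, the two summands are the
  complementary perfect matchings that alternate along the cycle.\<close>

lemma walk_edges_eq_alternate_edges:
  "mset (walk_edges (u # w)) = mset (alternate_edges (u # w)) + mset (alternate_edges w)"
  by (induction w arbitrary: u) (simp_all add: walk_edges_Cons)

text \<open>Closing an even cycle repeats its first node at the end, where it stays unpaired; one of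
  the two matchings is thus that of \<open>xs\<close> itself.\<close>

lemma alternate_edges_snoc: "even (length xs) \<Longrightarrow> alternate_edges (xs @ [x]) = alternate_edges xs"
  by (induction xs rule: alternate_edges.induct) auto

text \<open>The edges of the matching are disjoint pairs that cover \<open>U\<close>.\<close>

lemma even_card_perfect_matching:
  assumes "perfect_matching U M" "finite U"
  shows "even (card U)"
proof -
  have M: "M \<subseteq> edges_on U" using assms(1) by (simp add: perfect_matching_def)
  have two: "card e = 2" if "e \<in> M" for e using that M by (auto simp: edges_on_def)
  have U: "U = \<Union> M"
    using M Union_edges_on_subset[of U] assms(1) unfolding perfect_matching_def by blast
  have "disjoint M"
  proof (rule disjointI)
    fix a b assume "a \<in> M" "b \<in> M" "a \<noteq> b"
    then show "a \<inter> b = {}"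
      using assms(1) U unfolding perfect_matching_def by blast
  qed
  moreover have "finite e" if "e \<in> M" for e
    using two[OF that] card.infinite[of e] by fastforce
  ultimately have "card U = sum card M"
    unfolding U using card_Union_disjoint by blast
  then show ?thesis using two by simp
qed

text \<open>The even cycle obtained by shortcutting splits into two perfect matchings of
  \<open>U\<close>, and each of them costs at least as much as \<open>M\<close>.\<close>

lemma min_perfect_matching_le_closed_walk:
  assumes m: "metric_on V d" and M: "min_perfect_matching d U M"
    and w: "w \<noteq> []" "hd w = s" "last w = s" "set w \<subseteq> V" and U: "U \<subseteq> set w"
  shows "2 * sum (edge_weight d) M \<le> walk_cost d w"
proof (cases "U = {}")
  case True
  have "perfect_matching {} {}" by (simp add: perfect_matching_def)
  then have "sum (edge_weight d) M \<le> sum (edge_weight d) {}"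
    using M True unfolding min_perfect_matching_def by blast
  then show ?thesis using walk_cost_nonneg[OF m w(4)] by simp
next
  case False
  obtain xs where xs: "distinct xs" "set xs = U" "xs \<noteq> []"
    "walk_cost d (xs @ [hd xs]) \<le> walk_cost d w"
    using shortcut_closed_walk[OF m w U False] .
  obtain x ys where x: "xs = x # ys" using xs(3) by (cases xs) auto
  \<comment> \<open>Rotating the cycle by one node shifts the pairing and yields the complementary
    matching.\<close>
  let ?zs = "ys @ [x]"
  let ?W = "\<lambda>xs. sum (edge_weight d) (set (alternate_edges xs))"
  have "even (card U)"
    using M even_card_perfect_matching finite_subset[OF U]
    unfolding min_perfect_matching_def by blast
  then have even: "even (length xs)" using distinct_card[OF xs(1)] xs(2) by simp
  have zs: "distinct ?zs" "set ?zs = U" "even (length ?zs)" using xs even by (auto simp: x)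
  have le: "sum (edge_weight d) M \<le> ?W us" if "distinct us" "set us = U" "even (length us)" for us
    using M perfect_matching_alternate_edges[OF that(1,3)] that(2)
    unfolding min_perfect_matching_def by blast
  have W: "sum_mset (image_mset (edge_weight d) (mset (alternate_edges us))) = ?W us"
    if "distinct us" "even (length us)" for us
    using perfect_matching_alternate_edges[OF that]
    by (simp add: sum_list_distinct_conv_sum_set sum_mset_sum_list flip: mset_map)
  \<comment> \<open>For two nodes both matchings consist of the same edge, which the cycle traverses
    twice; the two sums are therefore kept apart.\<close>
  have "walk_cost d (xs @ [x]) = ?W xs + ?W ?zs"
  proof -
    have "set (xs @ [x]) \<subseteq> V" using xs U w by (auto simp: x)
    then have "walk_cost d (xs @ [x]) =
        sum_mset (image_mset (edge_weight d) (mset (walk_edges (x # ys @ [x]))))"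
      using walk_cost_eq_sum_edge_weights[OF m] by (simp add: x)
    then show ?thesis
      using W[OF xs(1) even] W[OF zs(1,3)] alternate_edges_snoc[OF even, of x]
      unfolding walk_edges_eq_alternate_edges by (simp add: x)
  qed
  then show ?thesis using le[OF xs(1,2) even] le[OF zs] xs(4) by (simp add: x)
qed

section \<open>Christofides' tour\<close>

lemma last_remdups: "last (remdups xs) = last xs"
  by (induction xs) auto

lemma christofides_tour_nodes:
  assumes "christofides_tour d s S vs"
  shows "vs \<noteq> []" "hd vs = s" "set vs = insert s S" "distinct vs"
proof -
  obtain w where w: "w \<noteq> []" "hd w = s" "set w = insert s S" "vs = rev (remdups (rev w))"
    using assms unfolding christofides_tour_def eulerian_circuit_def by blast
  then show "vs \<noteq> []" "set vs = insert s S" "distinct vs" by auto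
  \<comment> \<open>Keeping first occurrences leaves the start of the circuit in place.\<close>
  show "hd vs = s"
    using w by (simp add: hd_rev last_remdups last_rev)
qed

text \<open>The comparison is with any closed walk from \<open>s\<close> covering \<open>S\<close>,
  even one that leaves \<open>insert s S\<close>. This admits the optimal tour of an agent and the
  concatenation of all optimal tours. The tree contributes 1 and the matching 1/2 of the cost of
  \<open>w\<close>.\<close>

lemma christofides_tour_cost:
  assumes m: "metric_on V d" and c: "christofides_tour d s S vs"
    and w: "w \<noteq> []" "hd w = s" "last w = s" "set w \<subseteq> V" "S \<subseteq> set w"
  shows "walk_cost d (vs @ [s]) \<le> 3 / 2 * walk_cost d w"
proof -
  obtain E M t where E: "min_spanning_tree d (insert s S) E"
    and M: "min_perfect_matching d (odd_nodes (insert s S) E) M"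
    and t: "t \<noteq> []" "hd t = s" "last t = s" "set t = insert s S"
           "mset (walk_edges t) = mset_set E + mset_set M"
    and vs: "vs = rev (remdups (rev t))"
    using c unfolding christofides_tour_def eulerian_circuit_def by blast
  have U: "insert s S \<subseteq> set w" using w by auto
  then have tV: "set t \<subseteq> V" using t(4) w(4) by blast
  have "subseq (vs @ [s]) (t @ [s])"
    unfolding vs by (intro list_emb_append_mono subseq_first_occurrences) simp
  then have "walk_cost d (vs @ [s]) \<le> walk_cost d (t @ [s])"
    using U t w by (intro walk_cost_subseq[OF m]) auto
  also have "\<dots> = walk_cost d t"
    using walk_cost_close[OF m t(1-3)] U w by auto
  also have "\<dots> = sum (edge_weight d) E + sum (edge_weight d) M"
    using walk_cost_eq_sum_edge_weights[OF m tV] t(5) by (simp add: sum_unfold_sum_mset)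
  also have "\<dots> \<le> walk_cost d w + walk_cost d w / 2"
  proof -
    have "odd_nodes (insert s S) E \<subseteq> set w" using U by (auto simp: odd_nodes_def)
    then show ?thesis
      using min_spanning_tree_le_closed_walk[OF m E w(1-4) U]
        min_perfect_matching_le_closed_walk[OF m M w(1-4)] by simp
  qed
  finally show ?thesis by simp
qed

section \<open>Cost of the subtours\<close>

text \<open>The inner cost is a difference of prefix costs. Positions count from 0, so the first
  inner node \<open>vs ! a\<close> ends the prefix of length \<open>Suc a\<close>.\<close>

lemma subtour_cost:
  assumes "1 \<le> a" "a < b" "b \<le> length vs"
  shows "walk_cost d (s # drop a (take b vs) @ [s]) =
    d s (vs ! a) + (walk_cost d (take b vs) - walk_cost d (take (Suc a) vs)) + d (vs ! (b - 1)) s"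
proof -
  let ?X = "drop a (take b vs)" and ?P = "take a vs"
  have ne: "?X \<noteq> []" "?P \<noteq> []" using assms by auto
  have "hd ?X = vs ! a" using assms by (simp add: hd_drop_conv_nth)
  moreover have "last ?X = vs ! (b - 1)"
    using assms ne by (simp add: last_drop last_conv_nth)
  moreover have "take b vs = ?P @ ?X"
    using assms by (metis append_take_drop_id less_imp_le min.absorb1 take_take)
  then have "walk_cost d (take b vs) = walk_cost d ?P + d (last ?P) (hd ?X) + walk_cost d ?X"
    using walk_cost_append[OF ne(2,1), of d] by simp
  moreover have "walk_cost d (take (Suc a) vs) = walk_cost d ?P + d (last ?P) (vs ! a)"
    using walk_cost_append[of ?P "[vs ! a]" d] ne assms by (simp add: take_Suc_conv_app_nth)
  moreover have "walk_cost d (s # ?X @ [s]) = d s (hd ?X) + walk_cost d ?X + d (last ?X) s"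
    using walk_cost_append[of ?X "[s]" d] ne by (cases ?X) auto
  ultimately show ?thesis by simp
qed

text \<open>Away from the ends of the tour, an inner piece starts at a node reached at cost above
  \<open>B (j - 1)\<close> and ends at one reached at cost at most \<open>B j\<close>. These
  thresholds differ by \<open>(L - 2 * cmax) / q\<close>, and the two connecting edges add at most
  \<open>2 * cmax\<close>.\<close>

lemma splitour_cost:
  assumes m: "metric_on V d" and V: "set vs \<subseteq> V" "vs \<noteq> []" and q: "1 \<le> q"
    and t: "t \<in> set (fst (splitour d vs q))"
  defines "L \<equiv> walk_cost d (vs @ [hd vs])"
    and "cmax \<equiv> Max (insert 0 (d (hd vs) ` set (tl vs)))"
  shows "walk_cost d t \<le> L / q + 2 * cmax * (1 - 1 / q)"
proof -
  let ?s = "hd vs" and ?n = "length vs"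
  let ?W = "\<lambda>i. walk_cost d (take i vs)"
  define B where "B j = real j / real q * (L - 2 * cmax) + cmax" for j
  define A where "A j = {i \<in> {1..?n}. ?W i \<le> B j}" for j
  define p where "p j = (if j = 0 then 1 else if j = q then ?n else Max (A j))" for j
  have c0: "0 \<le> cmax" unfolding cmax_def by (rule Max_ge) auto
  have L: "2 * cmax \<le> L"
    unfolding cmax_def L_def using twice_max_dist_le_cost[OF m V] .
  have n: "1 \<le> ?n" using V(2) by (cases vs) auto
  have W1: "?W 1 = 0" using V(2) by (cases vs) auto
  have sV: "?s \<in> V" using V by auto
  have nth_V: "vs ! i \<in> V" if "i < ?n" for i using that V by auto
  have cmax: "d ?s (vs ! i) \<le> cmax" "d (vs ! i) ?s \<le> cmax" if "1 \<le> i" "i < ?n" for i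
  proof -
    have "vs ! i \<in> set (tl vs)" using that by (cases vs) (auto simp: nth_Cons')
    then show "d ?s (vs ! i) \<le> cmax" unfolding cmax_def by (intro Max_ge) auto
    then show "d (vs ! i) ?s \<le> cmax"
      using m sV nth_V[OF that(2)] unfolding metric_on_def by auto
  qed
  \<comment> \<open>The depot is reached at cost 0 and \<open>L \<ge> 2 * cmax\<close> makes every
    threshold nonnegative, so each \<open>Max (A j)\<close> is taken over a nonempty set.\<close>
  have A: "finite (A j)" "1 \<in> A j" for j
    using c0 L n W1 by (auto simp: A_def B_def)
  have p: "1 \<le> p j \<and> p j \<le> ?n" for j
  proof -
    have "Max (A j) \<in> A j" using A by (intro Max_in) auto
    then show ?thesis using n by (auto simp: p_def A_def)
  qed
  text \<open>The bounds \<open>upper\<close> and \<open>lower\<close> hold at the depot as well, with \<open>B 0 = cmax\<close> and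
    \<open>B q = L - cmax\<close>, so the first and the last subtour, where one of the two connecting edges
    is an edge of the tour, need no separate treatment.\<close>
  have upper: "?W (p j) + d (vs ! (p j - 1)) ?s \<le> B j + cmax" if "1 \<le> j" "j \<le> q" "2 \<le> p j" for j
  proof (cases "j = q")
    case True
    have "?W ?n + d (vs ! (?n - 1)) ?s = L"
      using walk_cost_append[of vs "[?s]" d] V(2) by (simp add: L_def last_conv_nth)
    then show ?thesis using True q by (simp add: p_def B_def)
  next
    case False
    have "Max (A j) \<in> A j" using A by (intro Max_in) auto
    then have "?W (p j) \<le> B j" using that False by (auto simp: p_def A_def)
    moreover have "1 \<le> p j - 1" "p j - 1 < ?n" using p[of j] that(3) by linarith+
    ultimately show ?thesis using cmax(2)[of "p j - 1"] by simp
  qed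
  have lower: "B j - cmax \<le> ?W (Suc (p j)) - d ?s (vs ! p j)" if "j < q" "p j < ?n" for j
  proof (cases "j = 0")
    case True
    \<comment> \<open>The first inner node is the second node of the tour. Its prefix cost is
      exactly the connecting edge, so the right side is 0, as is \<open>B 0 - cmax\<close>.\<close>
    then have pj: "p j = 1" by (simp add: p_def)
    then have "2 \<le> length vs" using that by simp
    then obtain x y r where "vs = x # y # r"
      by (metis Suc_le_length_iff numeral_2_eq_2)
    then show ?thesis using True pj by (simp add: B_def)
  next
    case False
    then have "p j = Max (A j)" using that by (simp add: p_def)
    \<comment> \<open>By maximality of the split point, the next node lies beyond the
      threshold.\<close>
    then have "Suc (p j) \<notin> A j"
      using Max_ge[OF A(1), of "Suc (p j)" j] by auto
    then have "B j < ?W (Suc (p j))" using that p by (auto simp: A_def)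
    then show ?thesis using cmax(1)[of "p j"] p[of j] that by simp
  qed
  have "fst (splitour d vs q) = map (\<lambda>j. ?s # drop (p (j - 1)) (take (p j) vs) @ [?s]) [1..<Suc q]"
    using fst_splitour[OF m V q] unfolding p_def A_def B_def L_def cmax_def .
  then obtain j where j: "1 \<le> j" "j \<le> q" "t = ?s # drop (p (j - 1)) (take (p j) vs) @ [?s]"
    using t by auto
  show ?thesis
  proof (cases "p (j - 1) < p j")
    case True
    have "walk_cost d t =
        d ?s (vs ! p (j - 1)) + (?W (p j) - ?W (Suc (p (j - 1)))) + d (vs ! (p j - 1)) ?s"
      unfolding j(3) using True p[of j] p[of "j - 1"] by (intro subtour_cost) auto
    also have "\<dots> \<le> (B j + cmax) - (B (j - 1) - cmax)"
    proof -
      have "2 \<le> p j" "p (j - 1) < ?n" "j - 1 < q"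
        using True p[of j] p[of "j - 1"] j by linarith+
      then show ?thesis using upper[OF j(1,2)] lower[of "j - 1"] by linarith
    qed
    also have "\<dots> = L / q + 2 * cmax * (1 - 1 / q)"
      using j(1) q by (simp add: B_def of_nat_diff field_simps)
    finally show ?thesis .
  next
    case False
    \<comment> \<open>Split points may coincide; an empty piece gives the trivial tour from the
      depot to itself.\<close>
    then have "walk_cost d t = 0"
      using m sV by (simp add: j(3) metric_on_def)
    also have "0 \<le> L / q + 2 * cmax * (1 - 1 / q)"
      using c0 L q by (intro add_nonneg_nonneg mult_nonneg_nonneg) (auto simp: field_simps)
    finally show ?thesis .
  qed
qed

lemma splitour_subtours:
  assumes m: "metric_on V d" and V: "set vs \<subseteq> V" "vs \<noteq> []" and q: "1 \<le> q"
  shows "length (fst (splitour d vs q)) = q"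
    and "t \<in> set (fst (splitour d vs q)) \<Longrightarrow>
      \<exists>us. t = hd vs # us @ [hd vs] \<and> set us \<subseteq> set vs \<and> length us \<le> length vs"
    and "v \<in> set vs \<Longrightarrow> \<exists>t \<in> set (fst (splitour d vs q)). v \<in> set t"
proof -
  let ?L = "walk_cost d (vs @ [hd vs])" and ?c = "Max (insert 0 (d (hd vs) ` set (tl vs)))"
  define p where "p j = (if j = 0 then 1 else if j = q then length vs else
     Max {i \<in> {1..length vs}. walk_cost d (take i vs) \<le> real j / real q * (?L - 2 * ?c) + ?c})" for j
  have p0: "p 0 = 1" and pq: "p q = length vs" using q by (auto simp: p_def)
  have subtours: "fst (splitour d vs q) =
      map (\<lambda>j. hd vs # drop (p (j - 1)) (take (p j) vs) @ [hd vs]) [1..<Suc q]"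
    using fst_splitour[OF m V q] unfolding p_def .
  have subtour: "hd vs # drop (p (j - 1)) (take (p j) vs) @ [hd vs] \<in> set (fst (splitour d vs q))"
    if "1 \<le> j" "j \<le> q" for j
    unfolding subtours set_map by (rule image_eqI[of _ _ j]) (use that in auto)
  show "length (fst (splitour d vs q)) = q" using q by (simp add: subtours)
  show "\<exists>us. t = hd vs # us @ [hd vs] \<and> set us \<subseteq> set vs \<and> length us \<le> length vs"
    if t: "t \<in> set (fst (splitour d vs q))"
  proof -
    obtain a b where "t = hd vs # drop a (take b vs) @ [hd vs]" using t unfolding subtours by auto
    moreover have "set (drop a (take b vs)) \<subseteq> set vs"
      by (meson order_trans set_drop_subset set_take_subset)
    moreover have "length (drop a (take b vs)) \<le> length vs" by auto
    ultimately show ?thesis by blast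
  qed
  show "\<exists>t \<in> set (fst (splitour d vs q)). v \<in> set t" if v: "v \<in> set vs"
  proof -
    obtain i where i: "i < length vs" "v = vs ! i" using v by (metis in_set_conv_nth)
    show ?thesis
    proof (cases "i = 0")
      case True
      then have "v = hd vs" using V(2) i by (simp add: hd_conv_nth)
      then show ?thesis using q by (intro bexI[OF _ subtour[of 1]]) auto
    next
      case False
      \<comment> \<open>Piece \<open>j\<close> holds the positions from \<open>p (j - 1)\<close> up
        to but excluding \<open>p j\<close>. Minimality of \<open>j\<close> gives
        \<open>p (j - 1) \<le> i\<close>.\<close>
      define j where "j = (LEAST j. i < p j)"
      have "i < p q" using i pq by simp
      then have j: "i < p j" "j \<le> q"
        unfolding j_def by (rule LeastI, rule Least_le)
      have "j \<noteq> 0" using j p0 False by (cases j) auto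
      then have "p (j - 1) \<le> i"
        using not_less_Least[of "j - 1" "\<lambda>j. i < p j"] unfolding j_def by simp
      then have "drop (p (j - 1)) (take (p j) vs) ! (i - p (j - 1)) = v"
          "i - p (j - 1) < length (drop (p (j - 1)) (take (p j) vs))"
        using i j by auto
      then have "v \<in> set (drop (p (j - 1)) (take (p j) vs))"
        by (metis nth_mem)
      then show ?thesis
        using j(2) \<open>j \<noteq> 0\<close> by (intro bexI[OF _ subtour[of j]]) auto
    qed
  qed
qed

text \<open>With one agent per type, the type-specific Christofides tours stay whole and keep the
  factor 3/2.\<close>

lemma splitour_one:
  assumes "metric_on V d" "set vs \<subseteq> V" "vs \<noteq> []"
  shows "fst (splitour d vs 1) = [vs @ [hd vs]]"
proof -
  have "[1..<Suc 1] = [1]" by simp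
  then show ?thesis
    using assms(3) unfolding fst_splitour[OF assms le_refl] by (simp only: list.map) (cases vs; simp)
qed

section \<open>Running time\<close>

lemma snd_enum_t [simp]: "snd (enum_t i n) = n + 1"
  by (induction i n rule: enum_t.induct) auto

lemma snd_map_t_le:
  "(\<And>x. x \<in> set xs \<Longrightarrow> snd (f x) \<le> B) \<Longrightarrow> snd (map_t f xs) \<le> length xs * (B + 1) + 1"
proof (induction xs)
  case (Cons x xs)
  have "snd (f x) \<le> B" "snd (map_t f xs) \<le> length xs * (B + 1) + 1" using Cons by auto
  then show ?case by simp
qed simp

lemma snd_walk_cost_t: "snd (walk_cost_t d w) \<le> length w + 1"
  by (induction d w rule: walk_cost_t.induct) auto

lemma snd_max_dist_t [simp]: "snd (max_dist_t d s vs) = length vs + 1"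
  by (induction vs) auto

lemma snd_last_within_t [simp]: "snd (last_within_t d b i p c u vs) = length vs + 1"
  by (induction vs arbitrary: i p c u) auto

text \<open>Each subtour takes one tick and three list operations of at most
  \<open>length vs + 1\<close> steps.\<close>

lemma snd_subtours_t_le: "snd (subtours_t vs ps) \<le> length ps * (3 * length vs + 4) + 1"
proof (induction vs ps rule: subtours_t.induct)
  case (1 vs p p' ps)
  have "snd (subtours_t vs (p' # ps)) \<le> length (p' # ps) * (3 * length vs + 4) + 1"
    by (rule 1) (rule refl)+
  moreover have "snd (subtours_t vs (p # p' # ps)) =
      1 + T_take p' vs + T_drop p (take p' vs) + T_append (drop p (take p' vs)) [hd vs]
        + snd (subtours_t vs (p' # ps))"
    by (simp add: take_t_def drop_t_def append_t_def)
  moreover have "T_take p' vs + T_drop p (take p' vs) + T_append (drop p (take p' vs)) [hd vs]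
      \<le> 3 * length vs + 3"
    unfolding T_take T_drop T_append by auto
  ultimately show ?case by simp
qed auto

text \<open>The \<open>q - 1\<close> scans and the \<open>q\<close> subtours dominate, each linear
  in the length of the tour. The generous product form absorbs all remaining terms.\<close>

lemma snd_splitour_le:
  assumes "vs \<noteq> []" "1 \<le> q"
  shows "snd (splitour d vs q) \<le> (q + 4) * (4 * length vs + 10)"
proof -
  let ?n = "length vs"
  define f where "f j = split_point_t d (real j / real q *
    (walk_cost d (vs @ [hd vs]) - 2 * fst (max_dist_t d (hd vs) (tl vs))) +
    fst (max_dist_t d (hd vs) (tl vs))) vs" for j
  define ps where "ps = map (fst \<circ> f) [1..<q] @ [?n]"
  have "snd (map_t f [1..<q]) \<le> length [1..<q] * (?n + 1) + 1"
    using assms by (intro snd_map_t_le) (simp add: f_def split_point_t_def)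
  moreover have "length [1..<q] * (?n + 1) \<le> q * (?n + 1)" by (intro mult_right_mono) auto
  moreover have "snd (subtours_t vs (1 # ps)) \<le> (q + 1) * (3 * ?n + 4) + 1"
    using snd_subtours_t_le[of vs "1 # ps"] assms by (simp add: ps_def)
  moreover have "snd (walk_cost_t d (vs @ [hd vs])) \<le> ?n + 2"
    using snd_walk_cost_t[of d "vs @ [hd vs]"] by simp
  \<comment> \<open>In this order: tick, closing the tour, its cost, \<open>cmax\<close>,
    enumerating \<open>q - 1\<close> indices, the scans, the length, appending it to the split
    points, the subtours.\<close>
  moreover have "snd (splitour d vs q) = 1 + (?n + 1) + snd (walk_cost_t d (vs @ [hd vs])) + ?n
      + q + snd (map_t f [1..<q]) + (?n + 1) + q + snd (subtours_t vs (1 # ps))"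
    using assms
    by (simp add: splitour_def append_t_def length_t_def T_append T_length fst_walk_cost_t
        fst_map_t fst_enum_t ps_def f_def[abs_def] del: upt_Suc)
  ultimately show ?thesis by (simp add: algebra_simps)
qed

lemma fst_count_type_t: "fst (count_type_t f i n) = card {j. j < n \<and> f j = i}"
proof (induction n)
  case (Suc n)
  have "{j. j < Suc n \<and> f j = i} = {j. j < n \<and> f j = i} \<union> (if f n = i then {n} else {})"
    by (auto simp: less_Suc_eq)
  then show ?case using Suc by simp
qed simp

lemma snd_count_type_t [simp]: "snd (count_type_t f i n) = n + 1"
  by (induction n) auto

text \<open>Natural coefficients are nonnegative. This lifts time bounds in the number of tasks to
  the instance size.\<close>

lemma poly_nat_mono: "x \<le> y \<Longrightarrow> poly p x \<le> poly p (y :: nat)"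
  by (induction p) (auto intro: add_mono mult_mono)

section \<open>Instances and optimal tours\<close>

lemma agent_type_bounds:
  assumes "htap_instance I" "j < n_agents I"
  shows "1 \<le> agent_type I j" "agent_type I j \<le> n_types I"
  using assms by (auto simp: htap_instance_def)

lemma tasks_subset_all_tasks: "i \<le> n_types I \<Longrightarrow> tasks I i \<subseteq> all_tasks I"
  by (auto simp: all_tasks_def)

text \<open>Every type has an agent, so \<open>agent_type\<close> is onto. The instance size thereby
  bounds the number of types as well.\<close>

lemma n_types_le_n_agents:
  assumes "htap_instance I"
  shows "n_types I \<le> n_agents I"
proof -
  have "{1..n_types I} \<subseteq> agent_type I ` {..<n_agents I}"
  proof
    fix i assume "i \<in> {1..n_types I}"
    then have "1 \<le> type_count I i" using assms by (simp add: htap_instance_def)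
    then have "card {j. j < n_agents I \<and> agent_type I j = i} \<noteq> 0"
      unfolding type_count_def by linarith
    then have "{j. j < n_agents I \<and> agent_type I j = i} \<noteq> {}" by (metis card.empty)
    then show "i \<in> agent_type I ` {..<n_agents I}" by auto
  qed
  then have "card {1..n_types I} \<le> card {..<n_agents I}" by (rule surj_card_le[rotated]) simp
  then show ?thesis by simp
qed

lemma type_count_le_n_agents: "type_count I i \<le> n_agents I"
proof -
  have "type_count I i \<le> card {..<n_agents I}"
    unfolding type_count_def by (rule card_mono) auto
  then show ?thesis by simp
qed

text \<open>Agent \<open>j\<close> itself is missing from the smaller set. The rank is thus a valid
  index into the subtours of its type.\<close>

lemma rank_within_type_less_type_count:
  assumes "j < n_agents I"
  shows "card {j'. j' < j \<and> agent_type I j' = agent_type I j} < type_count I (agent_type I j)"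
  unfolding type_count_def using assms by (intro psubset_card_mono) auto

text \<open>Task sets are disjoint, so a type-specific task can only go to an agent of that type,
  and by injectivity \<open>j\<close> is the only one.\<close>

lemma tasks_subset_allocated:
  assumes I: "htap_instance I" and S: "allocation I S"
    and inj: "inj_on (agent_type I) {..<n_agents I}" and j: "j < n_agents I"
  shows "tasks I (agent_type I j) \<subseteq> S j"
proof
  fix x assume x: "x \<in> tasks I (agent_type I j)"
  then have "x \<in> all_tasks I"
    using tasks_subset_all_tasks[OF agent_type_bounds(2)[OF I j]] by blast
  then obtain j' where j': "j' < n_agents I" "x \<in> S j'"
    using S unfolding allocation_def by blast
  then obtain i where i: "x \<in> tasks I i" "i = 0 \<or> i = agent_type I j'"
    using S unfolding allocation_def by blast
  have "i \<le> n_types I" using i(2) agent_type_bounds[OF I j'(1)] by auto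
  moreover have "tasks I i \<inter> tasks I (agent_type I j) \<noteq> {}" using i x by blast
  moreover have "disjoint_family_on (tasks I) {..n_types I}" using I by (simp add: htap_instance_def)
  ultimately have "i = agent_type I j"
    using disjoint_family_onD[of "tasks I" "{..n_types I}" i "agent_type I j"]
      agent_type_bounds(2)[OF I j] by auto
  then have "agent_type I j' = agent_type I j" using i(2) agent_type_bounds[OF I j] by auto
  then show "x \<in> S j" using inj j j' by (auto dest: inj_onD)
qed

lemma optimal_tours:
  assumes "htap_instance I"
  obtains S W where "allocation I S" "\<And>j. j < n_agents I \<Longrightarrow> is_tour I (S j) (W j)"
    "\<And>j. j < n_agents I \<Longrightarrow> tour_cost I (W j) \<le> htap_opt I"
proof -
  obtain S where S: "allocation I S"
      "htap_opt I = Max ((\<lambda>j. min_tour_cost I (S j)) ` {..<n_agents I})"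
    using htap_opt_attained(1)[OF assms] by blast
  have "\<exists>w. is_tour I (S j) w \<and> tour_cost I w \<le> htap_opt I" if j: "j < n_agents I" for j
  proof -
    have "S j \<subseteq> vertices I" using S(1) j by (auto simp: allocation_def vertices_def)
    then obtain w where "is_tour I (S j) w" "tour_cost I w = min_tour_cost I (S j)"
      using min_tour_cost_attained(1)[OF assms] by blast
    moreover have "min_tour_cost I (S j) \<le> htap_opt I"
      unfolding S(2) using j by (intro Max_ge) auto
    ultimately show ?thesis by auto
  qed
  then obtain W where "\<forall>j<n_agents I. is_tour I (S j) (W j) \<and> tour_cost I (W j) \<le> htap_opt I"
    by metis
  then show ?thesis using that S(1) by blast
qed

text \<open>Consecutive tours meet at the depot, where the joining loop costs 0.\<close>

lemma concatenated_tour: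
  assumes I: "htap_instance I" and "\<And>j. j < n \<Longrightarrow> is_tour I (S j) (W j)"
    and "\<And>j. j < n \<Longrightarrow> tour_cost I (W j) \<le> c"
  shows "\<exists>w. is_tour I (\<Union>j<n. S j) w \<and> tour_cost I w \<le> real n * c"
  using assms(2,3)
proof (induction n)
  case 0
  have "is_tour I {} [depot I]" by (simp add: is_tour_def vertices_def)
  then show ?case by (intro exI[of _ "[depot I]"]) simp
next
  case (Suc n)
  then obtain w where w: "is_tour I (\<Union>j<n. S j) w" "tour_cost I w \<le> real n * c"
    by (meson less_Suc_eq)
  have Wn: "is_tour I (S n) (W n)" "tour_cost I (W n) \<le> c" using Suc.prems by auto
  have "distance I (depot I) (depot I) = 0"
    using I by (simp add: htap_instance_def metric_on_def vertices_def)
  then have "tour_cost I (w @ W n) = tour_cost I w + tour_cost I (W n)"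
    using walk_cost_append[of w "W n" "distance I"] w Wn by (simp add: is_tour_def)
  moreover have "is_tour I (\<Union>j<Suc n. S j) (w @ W n)"
    using w(1) Wn(1) unfolding is_tour_def lessThan_Suc UN_insert by auto
  ultimately show ?case
    using w(2) Wn(2) by (intro exI[of _ "w @ W n"]) (simp add: algebra_simps)
qed

text \<open>The walk \<open>w\<close> itself serves as the node list in the bound for
  \<open>cmax\<close>: it starts at the depot, and closing it once more adds a loop of cost
  0.\<close>

lemma twice_distance_le_tour_cost:
  assumes "htap_instance I" "is_tour I S w" "v \<in> S"
  shows "2 * distance I (depot I) v \<le> tour_cost I w"
proof -
  let ?d = "distance I" and ?s = "depot I"
  have m: "metric_on (vertices I) ?d" using assms(1) by (simp add: htap_instance_def)
  have w: "w \<noteq> []" "hd w = ?s" "last w = ?s" "set w \<subseteq> vertices I" "v \<in> set w"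
    using assms(2,3) by (auto simp: is_tour_def)
  have "2 * ?d ?s v \<le> 2 * Max (insert 0 (?d ?s ` set (tl w)))"
  proof (cases "v = ?s")
    case True
    then have "?d ?s v = 0" using m by (simp add: metric_on_def vertices_def)
    then show ?thesis by simp
  next
    case False
    then have "v \<in> set (tl w)" using w by (cases w) auto
    then show ?thesis by simp
  qed
  also have "\<dots> \<le> walk_cost ?d (w @ [?s])"
    using twice_max_dist_le_cost[OF m w(4,1)] w(2) by simp
  also have "\<dots> = walk_cost ?d w"
    using walk_cost_close[OF m w(1-3)] by (simp add: vertices_def)
  finally show ?thesis .
qed

section \<open>CycleSplit\<close>

text \<open>Types count from 1 and list positions from 0, so the subtours of type \<open>i\<close>
  are found at position \<open>i - 1\<close>.\<close>

lemma fst_cycle_split: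
  assumes "htap_instance I"
  shows "fst (cycle_split chr I) =
    map (\<lambda>j. fst (splitour (distance I)
            (fst (chr (distance I) (depot I) (tasks I (agent_type I j))))
            (type_count I (agent_type I j))) ! card {j'. j' < j \<and> agent_type I j' = agent_type I j} @
          tl (fst (splitour (distance I) (fst (chr (distance I) (depot I) (tasks I 0)))
            (n_agents I)) ! j))
      [0..<n_agents I]"
proof -
  have "agent_type I j - Suc 0 < n_types I" "Suc (agent_type I j - Suc 0) = agent_type I j"
       "agent_type I j < Suc (n_types I)"
    if "j < n_agents I" for j
    using agent_type_bounds[OF assms that] by auto
  then show ?thesis
    by (auto simp: cycle_split_def fst_map_t fst_enum_t nth_t_def append_t_def fst_count_type_t
        type_count_def simp del: upt_Suc)
qed

lemma christofides_on_tasks: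
  fixes chr :: "('a \<Rightarrow> 'a \<Rightarrow> real) \<Rightarrow> 'a \<Rightarrow> 'a set \<Rightarrow> 'a list timed"
  assumes chr: "christofides_algorithm chr" and I: "htap_instance I" and i: "i \<le> n_types I"
  shows "finite (tasks I i)" "depot I \<notin> tasks I i"
    "metric_on (insert (depot I) (tasks I i)) (distance I)"
    "christofides_tour (distance I) (depot I) (tasks I i)
       (fst (chr (distance I) (depot I) (tasks I i)))"
proof -
  have sub: "tasks I i \<subseteq> all_tasks I" by (rule tasks_subset_all_tasks[OF i])
  then show f: "finite (tasks I i)" and s: "depot I \<notin> tasks I i"
    using I finite_subset unfolding htap_instance_def by blast+
  have "insert (depot I) (tasks I i) \<subseteq> vertices I" using sub by (auto simp: vertices_def)
  then show m: "metric_on (insert (depot I) (tasks I i)) (distance I)"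
    using I unfolding htap_instance_def metric_on_def by (meson subsetD)
  then show "christofides_tour (distance I) (depot I) (tasks I i)
       (fst (chr (distance I) (depot I) (tasks I i)))"
    using chr f s unfolding christofides_algorithm_def by blast
qed

lemma cycle_split_polynomial_time:
  fixes chr :: "('a \<Rightarrow> 'a \<Rightarrow> real) \<Rightarrow> 'a \<Rightarrow> 'a set \<Rightarrow> 'a list timed"
  assumes chr: "christofides_algorithm chr"
  shows "\<exists>p. \<forall>I. htap_instance I \<longrightarrow> snd (cycle_split chr I) \<le> poly p (instance_size I)"
proof -
  obtain p where p: "\<forall>d s S. finite S \<and> s \<notin> S \<and> metric_on (insert s S) d \<longrightarrow>
      snd (chr d s S) \<le> poly p (card S)"
    using chr[unfolded christofides_algorithm_def, THEN conjunct2] by (rule exE)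
  \<comment> \<open>The factor \<open>[:1, 1:]\<close> stands for at most \<open>N\<close> types
    plus the generic tasks, each with one Christofides run bounded by \<open>p\<close> and one split
    bounded by the product of linear polynomials. The last summand collects the bookkeeping.\<close>
  have "snd (cycle_split chr I) \<le>
      poly ([:1, 1:] * (p + [:4, 1:] * [:10, 4:]) + [:5, 8, 6:]) (instance_size I)"
    if I: "htap_instance I" for I
  proof -
    let ?d = "distance I" and ?s = "depot I" and ?f = "agent_type I" and ?k = "n_agents I"
    define N where "N = instance_size I"
    define P where "P = poly p N"
    define Q where "Q = (N + 4) * (4 * N + 10)"
    define vs where "vs i = fst (chr ?d ?s (tasks I i))" for i
    define sub where "sub i q = splitour ?d (vs i) q" for i q
    have m: "metric_on (vertices I) ?d" using I by (simp add: htap_instance_def)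
    have k: "?k \<le> N" "1 \<le> ?k" "n_types I \<le> N"
      using I n_types_le_n_agents[OF I] by (auto simp: N_def instance_size_def htap_instance_def)
    have vs: "vs i \<noteq> []" "set (vs i) \<subseteq> vertices I" "length (vs i) \<le> N"
        "snd (chr ?d ?s (tasks I i)) \<le> P" if i: "i \<le> n_types I" for i
    proof -
      note c = christofides_on_tasks[OF chr I i]
      note n = christofides_tour_nodes[OF c(4), folded vs_def]
      show "vs i \<noteq> []" by (rule n(1))
      show V: "set (vs i) \<subseteq> vertices I"
        using n(3) tasks_subset_all_tasks[OF i] by (auto simp: vertices_def)
      have "length (vs i) = card (set (vs i))" using n(4) by (simp add: distinct_card)
      also have "\<dots> \<le> card (vertices I)" by (rule card_mono[OF finite_vertices[OF I] V])
      finally show "length (vs i) \<le> N" by (simp add: N_def instance_size_def)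
      have "card (tasks I i) \<le> card (vertices I)"
        using tasks_subset_all_tasks[OF i]
        by (intro card_mono finite_vertices[OF I]) (auto simp: vertices_def)
      then have "poly p (card (tasks I i)) \<le> P"
        unfolding P_def N_def instance_size_def by (intro poly_nat_mono) simp
      then show "snd (chr ?d ?s (tasks I i)) \<le> P"
        using p c(1-3) by (meson order_trans)
    qed
    \<comment> \<open>A subtour has at most \<open>N\<close> inner nodes and the depot at both ends,
      hence the length \<open>N + 2\<close>.\<close>
    have sub: "snd (sub i q) \<le> Q" "length (fst (sub i q)) = q"
        "\<And>t. t \<in> set (fst (sub i q)) \<Longrightarrow> length t \<le> N + 2"
      if "i \<le> n_types I" "1 \<le> q" "q \<le> N" for i q
    proof -
      have "snd (sub i q) \<le> (q + 4) * (4 * length (vs i) + 10)"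
        unfolding sub_def using vs(1) that by (intro snd_splitour_le) auto
      also have "\<dots> \<le> Q"
        unfolding Q_def using vs(3)[OF that(1)] that by (intro mult_mono) auto
      finally show "snd (sub i q) \<le> Q" .
      note split = splitour_subtours[OF m vs(2)[OF that(1)] vs(1)[OF that(1)] that(2), folded sub_def]
      show "length (fst (sub i q)) = q" by (rule split(1))
      show "length t \<le> N + 2" if t: "t \<in> set (fst (sub i q))" for t
        using split(2)[OF t] vs(3)[OF \<open>i \<le> n_types I\<close>] by auto
    qed
    have tc: "1 \<le> type_count I i" "type_count I i \<le> N" if "i \<in> {1..n_types I}" for i
      using I that type_count_le_n_agents[of I i] k by (auto simp: htap_instance_def)
    define F where "F i = do {
        vs \<leftarrow> chr ?d ?s (tasks I i);
        q \<leftarrow> count_type_t ?f i ?k;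
        splitour ?d vs q
      }" for i
    define G where "G j = do {
         ts \<leftarrow> nth_t (map (fst \<circ> F) [1..<1 + n_types I]) (?f j - 1);
         r \<leftarrow> count_type_t ?f (?f j) j;
         t \<leftarrow> nth_t ts r;
         g \<leftarrow> nth_t (fst (sub 0 ?k)) j;
         append_t t (tl g)
       }" for j
    have fst_F: "fst (F i) = fst (sub i (type_count I i))" for i
      by (simp add: F_def sub_def vs_def fst_count_type_t type_count_def)
    have "snd (F i) \<le> P + N + 1 + Q" if i: "i \<in> set [1..<1 + n_types I]" for i
    proof -
      have "snd (F i) = snd (chr ?d ?s (tasks I i)) + (?k + 1) + snd (sub i (type_count I i))"
        by (simp add: F_def sub_def vs_def fst_count_type_t type_count_def)
      then show ?thesis
        using vs(4)[of i] sub(1)[of i "type_count I i"] tc[of i] k i by auto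
    qed
    then have "snd (map_t F [1..<1 + n_types I]) \<le> n_types I * (P + N + 1 + Q + 1) + 1"
      using snd_map_t_le[of "[1..<1 + n_types I]" F "P + N + 1 + Q"] by (simp del: upt_Suc)
    also have "\<dots> \<le> N * (P + N + 1 + Q + 1) + 1"
      using k(3) by (intro add_mono mult_mono) auto
    finally have F: "snd (map_t F [1..<1 + n_types I]) \<le> N * (P + N + 1 + Q + 1) + 1" .
    \<comment> \<open>Three list lookups and one count take at most \<open>N\<close> steps each, the
      final concatenation at most \<open>N + 3\<close>.\<close>
    have "snd (G j) \<le> 5 * N + 3" if j: "j \<in> set [0..<?k]" for j
    proof -
      have j: "j < ?k" using j by simp
      let ?r = "card {j'. j' < j \<and> ?f j' = ?f j}" and ?ts = "fst (sub (?f j) (type_count I (?f j)))"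
      note b = agent_type_bounds[OF I j]
      have ts: "length ?ts = type_count I (?f j)" "\<And>t. t \<in> set ?ts \<Longrightarrow> length t \<le> N + 2"
        using sub(2,3)[of "?f j" "type_count I (?f j)"] tc[of "?f j"] b by auto
      then have r: "?r < length ?ts" "length ?ts \<le> N"
        using rank_within_type_less_type_count[OF j] tc[of "?f j"] b by auto
      have nth: "map (fst \<circ> F) [1..<1 + n_types I] ! (?f j - 1) = ?ts"
        using b by (simp add: fst_F del: upt_Suc)
      have "snd (G j) = T_nth (map (fst \<circ> F) [1..<1 + n_types I]) (?f j - 1) + (j + 1) +
          T_nth ?ts ?r + T_nth (fst (sub 0 ?k)) j + T_append (?ts ! ?r) (tl (fst (sub 0 ?k) ! j))"
        unfolding G_def using nth by (simp add: nth_t_def append_t_def fst_count_type_t)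
      also have "T_nth (map (fst \<circ> F) [1..<1 + n_types I]) (?f j - 1) = ?f j"
        using b by (subst T_nth) auto
      also have "T_nth ?ts ?r = ?r + 1" by (rule T_nth[OF r(1)])
      also have "T_nth (fst (sub 0 ?k)) j = j + 1"
        using sub(2)[of 0 ?k] k j by (intro T_nth) simp
      also have "T_append (?ts ! ?r) (tl (fst (sub 0 ?k) ! j)) \<le> N + 3"
        using ts(2)[OF nth_mem[OF r(1)]] by (simp add: T_append)
      finally show ?thesis using b r k j by linarith
    qed
    then have "snd (map_t G [0..<?k]) \<le> ?k * (5 * N + 3 + 1) + 1"
      using snd_map_t_le[of "[0..<?k]" G "5 * N + 3"] by simp
    also have "\<dots> \<le> N * (5 * N + 3 + 1) + 1"
      using k(1) by (intro add_mono mult_mono) auto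
    finally have G: "snd (map_t G [0..<?k]) \<le> N * (5 * N + 3 + 1) + 1" .
    have "snd (cycle_split chr I) = 1 + (n_types I + 1) + snd (map_t F [1..<1 + n_types I]) +
        snd (chr ?d ?s (tasks I 0)) + snd (sub 0 ?k) + (?k + 1) + snd (map_t G [0..<?k])"
      unfolding cycle_split_def F_def[symmetric, abs_def] G_def[abs_def]
      by (simp add: fst_enum_t fst_map_t sub_def vs_def del: upt_Suc)
    also have "\<dots> \<le> 1 + (N + 1) + (N * (P + N + 1 + Q + 1) + 1) + P + Q + (N + 1) +
        (N * (5 * N + 3 + 1) + 1)"
      using F G vs(4)[of 0] sub(1)[of 0 ?k] k by linarith
    also have "\<dots> = (1 + N) * (P + Q) + (5 + N * (8 + N * 6))"
      by (simp add: algebra_simps)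
    also have "\<dots> = poly ([:1, 1:] * (p + [:4, 1:] * [:10, 4:]) + [:5, 8, 6:]) N"
      by (simp add: P_def Q_def algebra_simps)
    finally show ?thesis by (simp add: N_def)
  qed
  then show ?thesis by blast
qed

lemma cycle_split_distinct_types:
  fixes chr :: "('a \<Rightarrow> 'a \<Rightarrow> real) \<Rightarrow> 'a \<Rightarrow> 'a set \<Rightarrow> 'a list timed"
  assumes chr: "christofides_algorithm chr" and I: "htap_instance I"
    and one: "\<forall>i\<in>{1..n_types I}. type_count I i = 1"
  shows "feasible_solution I (fst (cycle_split chr I))"
    and "solution_value I (fst (cycle_split chr I)) \<le> (4 - 1 / real (n_agents I)) * htap_opt I"
proof -
  let ?d = "distance I" and ?s = "depot I" and ?f = "agent_type I" and ?k = "n_agents I"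
  let ?opt = "htap_opt I"
  define vs where "vs i = fst (chr ?d ?s (tasks I i))" for i
  define gen where "gen = fst (splitour ?d (vs 0) ?k)"
  have m: "metric_on (vertices I) ?d" and k: "1 \<le> ?k" using I by (auto simp: htap_instance_def)
  have s: "?s \<in> vertices I" "?d ?s ?s = 0" using m by (auto simp: vertices_def metric_on_def)
  have tour: "christofides_tour ?d ?s (tasks I i) (vs i)" if "i \<le> n_types I" for i
    using christofides_on_tasks(4)[OF chr I that] by (simp add: vs_def)
  have vs: "vs i \<noteq> []" "hd (vs i) = ?s" "set (vs i) = insert ?s (tasks I i)" "distinct (vs i)"
    "set (vs i) \<subseteq> vertices I" if "i \<le> n_types I" for i
    using christofides_tour_nodes[OF tour[OF that]] tasks_subset_all_tasks[OF that]
    by (auto simp: vertices_def)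
  have singleton: "card {j'. j' < ?k \<and> ?f j' = ?f j} = 1" if "j < ?k" for j
    using one agent_type_bounds[OF I that] by (simp add: type_count_def)
  have inj: "inj_on ?f {..<?k}"
  proof (rule inj_onI)
    fix j j' assume j: "j \<in> {..<?k}" "j' \<in> {..<?k}" "?f j = ?f j'"
    obtain a where "{j'. j' < ?k \<and> ?f j' = ?f j} = {a}"
      using singleton[of j] j by (auto simp: card_1_singleton_iff)
    then show "j = j'" using j by (metis (mono_tags, lifting) lessThan_iff mem_Collect_eq singletonD)
  qed
  note gen = splitour_subtours[OF m vs(5,1)[OF le0] k, folded gen_def]
  have gen_nth: "gen ! j \<in> set gen" if "j < ?k" for j using gen(1) that by simp
  define u where "u j = vs (?f j) @ [?s]" for j
  have result: "fst (cycle_split chr I) = map (\<lambda>j. u j @ tl (gen ! j)) [0..<?k]"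
    unfolding fst_cycle_split[OF I] vs_def[symmetric] gen_def[symmetric]
  proof (rule map_cong[OF refl])
    fix j assume "j \<in> set [0..<?k]"
    then have j: "j < ?k" by simp
    note b = agent_type_bounds[OF I j]
    have "type_count I (?f j) = 1" using one b by simp
    then have "fst (splitour ?d (vs (?f j)) (type_count I (?f j))) = [u j]"
      using splitour_one[OF m vs(5,1)[OF b(2)]] vs(2)[OF b(2)] by (simp add: u_def)
    moreover have "card {j'. j' < j \<and> ?f j' = ?f j} = 0"
      using rank_within_type_less_type_count[OF j] \<open>type_count I (?f j) = 1\<close> by simp
    ultimately show "fst (splitour ?d (vs (?f j)) (type_count I (?f j))) !
        card {j'. j' < j \<and> ?f j' = ?f j} @ tl (gen ! j) = u j @ tl (gen ! j)"
      by (simp only: nth_Cons_0)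
  qed
  have gen_form: "\<exists>us. gen ! j = ?s # us @ [?s] \<and> set us \<subseteq> insert ?s (tasks I 0)" if "j < ?k" for j
    using gen(2)[OF gen_nth[OF that]] vs(2,3)[OF le0] by auto
  show "feasible_solution I (fst (cycle_split chr I))"
    unfolding feasible_solution_def
  proof (intro conjI exI allI impI)
    \<comment> \<open>The intersection removes the depot, which lies on every subtour but is no
      task.\<close>
    let ?R = "\<lambda>j. set (gen ! j) \<inter> tasks I 0"
    let ?S = "\<lambda>j. tasks I (?f j) \<union> ?R j"
    show "length (fst (cycle_split chr I)) = ?k" by (simp add: result)
    show "allocation I ?S"
      unfolding allocation_def
    proof (intro conjI exI allI impI)
      show "(\<Union>j<?k. ?S j) = all_tasks I"
      proof (intro equalityI subsetI)
        fix x assume "x \<in> (\<Union>j<?k. ?S j)"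
        then obtain j where "j < ?k" "x \<in> tasks I (?f j) \<union> tasks I 0" by blast
        then show "x \<in> all_tasks I"
          using tasks_subset_all_tasks[of 0 I] tasks_subset_all_tasks[OF agent_type_bounds(2)[OF I]]
          by blast
      next
        fix x assume "x \<in> all_tasks I"
        then obtain i where i: "i \<le> n_types I" "x \<in> tasks I i" by (auto simp: all_tasks_def)
        show "x \<in> (\<Union>j<?k. ?S j)"
        proof (cases "i = 0")
          case True
          then obtain t where "t \<in> set gen" "x \<in> set t"
            using gen(3)[of x] vs(3)[OF le0] i by auto
          then obtain j where "j < ?k" "x \<in> set (gen ! j)"
            using gen(1) by (metis in_set_conv_nth)
          then show ?thesis using i True by blast
        next
          case False
          then have "card {j. j < ?k \<and> ?f j = i} \<noteq> 0"
            using one i by (simp add: type_count_def)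
          then have "{j. j < ?k \<and> ?f j = i} \<noteq> {}" by (metis card.empty)
          then show ?thesis using i by blast
        qed
      qed
    qed auto
    fix j assume j: "j < ?k"
    obtain us where us: "gen ! j = ?s # us @ [?s]" "set us \<subseteq> insert ?s (tasks I 0)"
      using gen_form[OF j] by blast
    note b = agent_type_bounds(2)[OF I j]
    have "is_tour I (?S j) (u j @ tl (gen ! j))"
      using vs[OF b] us s tasks_subset_all_tasks[of 0 I]
      by (auto simp: is_tour_def u_def vertices_def)
    then show "is_tour I (?S j) (fst (cycle_split chr I) ! j)"
      using j by (simp add: result)
  qed
  obtain S W where S: "allocation I S" and W: "\<And>j. j < ?k \<Longrightarrow> is_tour I (S j) (W j)"
      "\<And>j. j < ?k \<Longrightarrow> tour_cost I (W j) \<le> ?opt"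
    using optimal_tours[OF I] by blast
  \<comment> \<open>This covers the default value 0 in the maximum that defines
    \<open>cmax\<close>.\<close>
  have opt_nonneg: "0 \<le> ?opt"
    using W[of 0] k walk_cost_nonneg[OF m, of "W 0"] by (auto simp: is_tour_def)
  have all: "(\<Union>j<?k. S j) = all_tasks I" using S by (simp add: allocation_def)
  have specific: "tour_cost I (u j) \<le> 3 / 2 * ?opt" if j: "j < ?k" for j
  proof -
    note b = agent_type_bounds(2)[OF I j]
    have "tasks I (?f j) \<subseteq> set (W j)"
      using tasks_subset_allocated[OF I S inj j] W(1)[OF j] by (auto simp: is_tour_def)
    then have "tour_cost I (u j) \<le> 3 / 2 * tour_cost I (W j)"
      unfolding u_def using W(1)[OF j]
      by (intro christofides_tour_cost[OF m tour[OF b]]) (auto simp: is_tour_def)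
    then show ?thesis using W(2)[OF j] by simp
  qed
  define L where "L = walk_cost ?d (vs 0 @ [hd (vs 0)])"
  define cmax where "cmax = Max (insert 0 (?d (hd (vs 0)) ` set (tl (vs 0))))"
  have "L \<le> 3 / 2 * (real ?k * ?opt)"
  proof -
    obtain w where w: "is_tour I (all_tasks I) w" "tour_cost I w \<le> real ?k * ?opt"
      using concatenated_tour[OF I, of ?k S W ?opt] W unfolding all by blast
    then have "L \<le> 3 / 2 * tour_cost I w"
      unfolding L_def vs(2)[OF le0] using tasks_subset_all_tasks[of 0 I]
      by (intro christofides_tour_cost[OF m tour[OF le0]]) (auto simp: is_tour_def)
    then show ?thesis using w(2) by simp
  qed
  moreover have "2 * cmax \<le> ?opt"
  proof -
    have "2 * ?d ?s v \<le> ?opt" if "v \<in> set (tl (vs 0))" for v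
    proof -
      have "v \<in> insert ?s (tasks I 0)"
        using that vs(1,3)[OF le0] by (metis list.set_sel(2))
      \<comment> \<open>The tour lists the depot first and has no repetition, so \<open>v\<close> is
        a genuine task.\<close>
      moreover have "v \<noteq> ?s"
        using that vs(1,2,4)[OF le0] by (cases "vs 0") auto
      ultimately have "v \<in> all_tasks I" using tasks_subset_all_tasks[of 0 I] by auto
      then obtain j where "j < ?k" "v \<in> S j" using all by auto
      then show ?thesis
        using twice_distance_le_tour_cost[OF I W(1)] W(2) by fastforce
    qed
    then have "\<forall>x \<in> insert 0 (?d ?s ` set (tl (vs 0))). 2 * x \<le> ?opt"
      using opt_nonneg by auto
    moreover have "cmax \<in> insert 0 (?d ?s ` set (tl (vs 0)))"
      unfolding cmax_def vs(2)[OF le0] by (rule Max_in) auto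
    ultimately show ?thesis by blast
  qed
  \<comment> \<open>Since \<open>1 - 1 / k\<close> is nonnegative for \<open>k \<ge> 1\<close>, the
    bound on \<open>2 * cmax\<close> may be multiplied by it.\<close>
  ultimately have "L / ?k + 2 * cmax * (1 - 1 / ?k) \<le> 3 / 2 * ?opt + ?opt * (1 - 1 / ?k)"
    using k by (intro add_mono mult_right_mono) (auto simp: field_simps)
  then have generic: "tour_cost I (gen ! j) \<le> 3 / 2 * ?opt + ?opt * (1 - 1 / ?k)" if "j < ?k" for j
    using splitour_cost[OF m vs(5,1)[OF le0] k, of "gen ! j"] gen_nth[OF that]
    unfolding gen_def L_def cmax_def by (meson order_trans)
  have "tour_cost I (u j @ tl (gen ! j)) \<le> (4 - 1 / ?k) * ?opt" if j: "j < ?k" for j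
  proof -
    obtain us where us: "gen ! j = ?s # us @ [?s]" using gen_form[OF j] by blast
    \<comment> \<open>\<open>u j\<close> ends at the depot and \<open>tl\<close> removes the depot
      from the front of the generic subtour, so the joining edge is the first edge of that
      subtour.\<close>
    have "tour_cost I (u j @ tl (gen ! j)) = tour_cost I (u j) + tour_cost I (gen ! j)"
      using walk_cost_append[of "u j" "tl (gen ! j)" ?d] walk_cost_append[of "[?s]" "tl (gen ! j)" ?d]
      by (simp add: us u_def)
    moreover have "(4 - 1 / ?k) * ?opt = 3 / 2 * ?opt + (3 / 2 * ?opt + ?opt * (1 - 1 / ?k))"
      by (simp add: algebra_simps)
    ultimately show ?thesis using specific[OF j] generic[OF j] by linarith
  qed
  moreover have "set (fst (cycle_split chr I)) \<noteq> {}" using k by (auto simp: result)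
  ultimately show "solution_value I (fst (cycle_split chr I)) \<le> (4 - 1 / ?k) * ?opt"
    unfolding solution_value_def by (intro Max.boundedI) (auto simp: result)
qed

theorem corollary2:
  fixes chr :: "('a \<Rightarrow> 'a \<Rightarrow> real) \<Rightarrow> 'a \<Rightarrow> 'a set \<Rightarrow> 'a list timed"
  assumes "christofides_algorithm chr"
  shows "approximation_algorithm (cycle_split chr)
           {I. htap_instance I \<and> (\<forall>i\<in>{1..n_types I}. type_count I i = 1)}
           (\<lambda>I. 4 - 1 / real (n_agents I))"
  using cycle_split_distinct_types[OF assms] cycle_split_polynomial_time[OF assms]
  unfolding approximation_algorithm_def by blast

end
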